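(* Let $C_1\subset\mathbb{R}^2$ be the (upper) distance trisector curve of the points $P_1=(0,1)$ and $P_2=(0,-1)$. Then $C_1$ is a transcendental curve, i.e. it is not algebraic: there is no nonzero polynomial $P\in\mathbb{R}[x,y]$ such that $P(x,y)=0$ for all $(x,y)\in C_1$.
   Context: Distances in $\mathbb{R}^2$ are Euclidean, and $d(z,S)=\inf_{s\in S}\|z-s\|$ for $S\subset\mathbb{R}^2$ nonempty. Fix $P_1=(0,1)$ and $P_2=(0,-1)$. The distance trisector curves of $P_1,P_2$ are the (known to exist and be unique) pair of curves $C_1,C_2\subset\mathbb{R}^2$ separating $P_1$ from $P_2$ such that $$C_1=\{z\in\mathbb{R}^2: d(z,P_1)=d(z,C_2)\},\qquad C_2=\{z\in\mathbb{R}^2: d(z,P_2)=d(z,C_1)\}.$$ $C_1$ is the upper curve (next to $P_1$) and is called the distance trisector curve; $C_2$ is its mirror image in the $x$-axis. It is known that $C_1=\{(x,f(x)):x\in\mathbb{R}\}$ is the graph of an even, convex, real-analytic function $f:\mathbb{R}\to\mathbb{R}$ with $f(0)=\tfrac13$. *)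

theory Defs
  imports "HOL-Analysis.Analysis" "HOL-Computational_Algebra.Polynomial"
begin

text \<open>
  The plane is \<^typ>\<open>real \<times> real\<close>, whose library metric is the Euclidean one
  (\<open>dist_prod_def\<close>).
\<close>

text \<open>
  The most liberal notion of a curve: no injectivity or regularity is required, and bounded and
  unbounded curves are both included.
\<close>

definition plane_curve :: "(real \<times> real) set \<Rightarrow> bool"
  where "plane_curve C \<longleftrightarrow>
    (\<exists>g :: real \<Rightarrow> real \<times> real. continuous_on UNIV g \<and> C = range g)"

definition separates :: "(real \<times> real) set \<Rightarrow> real \<times> real \<Rightarrow> real \<times> real \<Rightarrow> bool"
  where "separates C p q \<longleftrightarrow>
    p \<notin> C \<and> q \<notin> C \<and> \<not> connected_component (- C) p q"

text \<open>
  \<open>C\<^sub>1\<close> is the curve next to \<open>p\<close> and \<open>C\<^sub>2\<close> the one next to \<open>q\<close>.  The library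
  sets \<open>infdist z {} = 0\<close>, but a \<open>plane_curve\<close> is never empty.
\<close>

definition distance_trisector_curves ::
    "real \<times> real \<Rightarrow> real \<times> real \<Rightarrow> (real \<times> real) set \<Rightarrow> (real \<times> real) set \<Rightarrow> bool"
  where "distance_trisector_curves p q C\<^sub>1 C\<^sub>2 \<longleftrightarrow>
    plane_curve C\<^sub>1 \<and> plane_curve C\<^sub>2 \<and>
    separates C\<^sub>1 p q \<and> separates C\<^sub>2 p q \<and>
    C\<^sub>1 = {z. dist z p = infdist z C\<^sub>2} \<and>
    C\<^sub>2 = {z. dist z q = infdist z C\<^sub>1}"

text \<open>
  The ring $\mathbb{R}[x,y]$ is \<^typ>\<open>real poly poly\<close>, read as $\mathbb{R}[x][y]$: the outer
  indeterminate is $y$ and the coefficients are polynomials in $x$.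
\<close>

definition poly_xy :: "real poly poly \<Rightarrow> real \<Rightarrow> real \<Rightarrow> real"
  where "poly_xy P x y = poly (poly P [:y:]) x"

definition algebraic_curve :: "(real \<times> real) set \<Rightarrow> bool"
  where "algebraic_curve C \<longleftrightarrow>
    (\<exists>P :: real poly poly. P \<noteq> 0 \<and> (\<forall>(x, y) \<in> C. poly_xy P x y = 0))"

abbreviation transcendental_curve :: "(real \<times> real) set \<Rightarrow> bool"
  where "transcendental_curve C \<equiv> \<not> algebraic_curve C"

end

theory Submission
  imports Defs "HOL-Computational_Algebra.Field_as_Ring" "HOL-Computational_Algebra.Polynomial_Factorial"
begin

text \<open>
  Write the upper curve as the graph of $f$ and the lower one as the graph of $-g$.  A point
  $(x, y)$ is at least as close to $(0, 1)$ as to the point $(a, -g(a))$ exactly when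
  $2 y (1 + g(a)) \ge 1 + 2 a x - a^2 - g(a)^2$, so that $f(x)$ is the largest value at $x$ of a
  family of affine functions indexed by the points of the lower curve, and vice versa.  Thus $f$
  and $g$ are convex.  The index $a$ that is attained at $x$ is the \<^emph>\<open>foot\<close> of $x$: the point of
  the lower curve that is nearest to $(x, f(x))$.  Two geometric facts follow.  The tangent at
  $(x, f(x))$ is the perpendicular bisector of $(0, 1)$ and the foot, and the line from
  $(x, f(x))$ to its foot is normal to the lower curve.  Hence the foot $(a, g(a))$ and the slope
  $g'(a)$ determine $(x, f(x))$ and $f'(x)$ by one explicit rational map, \<open>advance\<close>.

  Passing to feet is possible for ever: every point of the upper curve has an infinite backward
  orbit under \<open>advance\<close> (\<open>backward_orbit\<close>).  The forward orbit of a point far out on the upper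
  curve is a different matter.  If $X_k, Y_k$ are the coordinates after $k$ steps, started at
  abscissa $t \to \infty$, then $X_{k+1} / X_k$ grows like a multiple of $R = X_1 / X_0$, which is
  unbounded, and $(X_k, Y_k)$ runs to infinity with a slope that differs from its limit by at
  least a multiple of $1 / R$ (\<open>orbit_asymptotics\<close>, \<open>V_alternates\<close>).  A nonzero polynomial of
  degree at most $k$ in $y$ cannot vanish at such points: its leading form vanishes in the limiting
  direction to order at most $k$, so after division by the leading power of $X_k$ it is at least a
  multiple of $|R|^{-k}$, whereas the other terms contribute only $O(1 / X_k) = o(R^{-k})$
  (\<open>orbit_leaves_curve\<close>).  In other words,
  an algebraic curve would need infinitely many different branches at infinity to contain these
  forward orbits.

  If the upper curve were algebraic, its forward orbits would be caught in an algebraic curve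
  nevertheless.  The slope is a rational function of the point on an algebraic curve, so every
  iterate of \<open>advance\<close> is a rational map there, and if it sends infinitely many points of an
  irreducible curve into an algebraic curve, it sends all of them there (\<open>incidence_spreads\<close>).
  Backward orbits supply the infinitely many points.  As only finitely many irreducible components
  are available, a pigeonhole argument finds one that reaches arbitrarily far out and is mapped
  into itself by an arbitrarily high iterate, which contradicts the previous paragraph
  (\<open>graph_not_algebraic\<close>).
\<close>

text \<open>
  Seeing \<^typ>\<open>real\<close> as a Euclidean ring makes its polynomials, and the polynomials over these, factorial
  rings.  Euclidean division on a field is ordinary division, so the simplification rules for quotients with
  remainder would now fire on every fraction of reals.
\<close>

declare div_mult_self1 [simp del] div_mult_self2 [simp del] div_mult_self3 [simp del]
  div_mult_self4 [simp del] div_mult_mult1 [simp del] div_mult_mult2 [simp del]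
  div_mult_mult1_if [simp del] div_minus_minus [simp del]
declare [[simproc del: cancel_div_mod_int int_div_cancel_numeral_factors int_div_cancel_factor
  int_mod_cancel_factor numeral_divmod]]

section \<open>Trisector curves as graphs\<close>

text \<open>
  The equation says that $(x, f(x))$ has the same distance from $(0, 1)$ and from $(a, -g(a))$.
\<close>

definition foot :: "(real \<Rightarrow> real) \<Rightarrow> (real \<Rightarrow> real) \<Rightarrow> real \<Rightarrow> real \<Rightarrow> bool"
  where "foot f g x a \<longleftrightarrow> 2 * f x * (1 + g a) = 1 + 2 * a * x - a\<^sup>2 - (g a)\<^sup>2"

text \<open>
  The two equidistance conditions after squaring the distances: the inequalities say that no
  point of the other curve is too close, the existence of feet that the minimal distance is
  attained. The second curve is the graph of $-g$; reflecting it makes the conditions symmetric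
  in $f$ and $g$, so that every fact about $f$ holds for $g$ as well.
\<close>

locale trisector_pair =
  fixes f g :: "real \<Rightarrow> real"
  assumes f_pos: "0 < f x" and g_pos: "0 < g x"
    and f_above: "1 + 2 * a * x - a\<^sup>2 - (g a)\<^sup>2 \<le> 2 * f x * (1 + g a)"
    and g_above: "1 + 2 * a * x - a\<^sup>2 - (f a)\<^sup>2 \<le> 2 * g x * (1 + f a)"
    and foot_in_g: "\<exists>a. foot f g x a"
    and foot_in_f: "\<exists>a. foot g f x a"

lemma dist_plane_squared: "(dist (z::real \<times> real) w)\<^sup>2 = (fst z - fst w)\<^sup>2 + (snd z - snd w)\<^sup>2"
  by (cases z; cases w) (simp add: dist_prod_def dist_real_def)

lemma dist_le_iff_squares:
  "dist (z::real \<times> real) w \<le> dist z' w' \<longleftrightarrow>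
    (fst z - fst w)\<^sup>2 + (snd z - snd w)\<^sup>2 \<le> (fst z' - fst w')\<^sup>2 + (snd z' - snd w')\<^sup>2"
  by (simp flip: dist_plane_squared)

lemma dist_eq_iff_squares:
  "dist (z::real \<times> real) w = dist z' w' \<longleftrightarrow>
    (fst z - fst w)\<^sup>2 + (snd z - snd w)\<^sup>2 = (fst z' - fst w')\<^sup>2 + (snd z' - snd w')\<^sup>2"
  using dist_le_iff_squares[of z w z' w'] dist_le_iff_squares[of z' w' z w] by linarith

lemma closed_equidistant: "closed {z::'a::metric_space. dist z p = infdist z S}"
  by (intro closed_Collect_eq continuous_intros)

text \<open>
  On the way from a point $w$ of \<open>D\<close> to $p$ one has to cross \<open>C\<close>,
  because the difference of the distances to $p$ and to \<open>D\<close> changes sign; and the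
  crossing is not $p$ itself.
\<close>

lemma closer_to_opposite_point:
  fixes C D :: "(real \<times> real) set"
  assumes C: "C = {z. dist z p = infdist z D}" and D: "D = {z. dist z q = infdist z C}"
    and "D \<noteq> {}" "p \<notin> D" and w: "w \<in> D"
  shows "dist w q < dist w p"
proof -
  have "closed D" unfolding D by (rule closed_equidistant)
  define \<phi> where "\<phi> z = dist z p - infdist z D" for z
  have "\<phi> w > 0" using w \<open>p \<notin> D\<close> by (auto simp: \<phi>_def)
  moreover have "\<phi> p < 0"
    using in_closed_iff_infdist_zero[OF \<open>closed D\<close> \<open>D \<noteq> {}\<close>, of p] \<open>p \<notin> D\<close>
      infdist_nonneg[of p D] by (simp add: \<phi>_def)
  moreover have "continuous_on (closed_segment w p) \<phi>"
    unfolding \<phi>_def by (intro continuous_intros)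
  then have "connected (\<phi> ` closed_segment w p)"
    by (rule connected_continuous_image) auto
  ultimately have "0 \<in> \<phi> ` closed_segment w p"
    by (meson connectedD_interval ends_in_segment image_eqI less_imp_le)
  then obtain z where z: "z \<in> closed_segment w p" "\<phi> z = 0" by auto
  then have "z \<in> C" "z \<noteq> p" using \<open>\<phi> p < 0\<close> by (auto simp: C \<phi>_def)
  then have "dist w q \<le> dist w z" using w infdist_le[of z C w] by (auto simp: D)
  also have "\<dots> < dist w p"
    using between[of w p z] z(1) \<open>z \<noteq> p\<close> by (auto simp: between_mem_segment dist_commute)
  finally show ?thesis .
qed

text \<open>
  The parameter $e$ is $1$ or $-1$ in the applications and exchanges the roles of the two
  curves.
\<close>

lemma opposite_side:
  fixes C D :: "(real \<times> real) set" and e :: real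
  assumes "C = {z. dist z (0, e) = infdist z D}" "D = {z. dist z (0, -e) = infdist z C}"
    and "D \<noteq> {}" "(0, e) \<notin> D" "w \<in> D"
  shows "e * snd w < 0"
proof -
  have "(dist w (0, -e))\<^sup>2 < (dist w (0, e))\<^sup>2"
    using closer_to_opposite_point[OF assms] by (intro power_strict_mono) auto
  then show ?thesis
    unfolding dist_plane_squared by (simp add: power2_eq_square algebra_simps)
qed

lemma curve_point_condition:
  fixes C D :: "(real \<times> real) set" and e :: real
  assumes C: "C = {z. dist z (0, e) = infdist z D}" and "closed D" "D \<noteq> {}" and e: "e * e = 1"
  shows "(x, e * y) \<in> C \<longleftrightarrow>
    (\<forall>a b. (a, - e * b) \<in> D \<longrightarrow> 1 + 2 * a * x - a\<^sup>2 - b\<^sup>2 \<le> 2 * y * (1 + b)) \<and>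
    (\<exists>a b. (a, - e * b) \<in> D \<and> 2 * y * (1 + b) = 1 + 2 * a * x - a\<^sup>2 - b\<^sup>2)"
    (is "_ \<longleftrightarrow> ?le \<and> ?eq")
proof -
  have e': "e * (e * t) = t" for t by (simp add: e flip: mult.assoc)
  have le: "dist (x, e * y) (0, e) \<le> dist (x, e * y) (a, - e * b) \<longleftrightarrow>
      1 + 2 * a * x - a\<^sup>2 - b\<^sup>2 \<le> 2 * y * (1 + b)" for a b
    by (simp add: dist_le_iff_squares power2_eq_square algebra_simps e e')
  have eq: "dist (x, e * y) (0, e) = dist (x, e * y) (a, - e * b) \<longleftrightarrow>
      2 * y * (1 + b) = 1 + 2 * a * x - a\<^sup>2 - b\<^sup>2" for a b
    by (auto simp: dist_eq_iff_squares power2_eq_square algebra_simps e e')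
  show ?thesis
  proof
    assume *: "(x, e * y) \<in> C"
    then have "?le" using infdist_le[of _ D "(x, e * y)"] by (auto simp: C simp flip: le)
    moreover obtain w where w: "w \<in> D" "infdist (x, e * y) D = dist (x, e * y) w"
      using infdist_attains_inf[OF \<open>closed D\<close> \<open>D \<noteq> {}\<close>] by blast
    have "w = (fst w, - e * (- e * snd w))" by (simp add: e')
    then obtain a b where "w = (a, - e * b)" by blast
    then have "?eq" using w * unfolding C eq[symmetric] by auto
    ultimately show "?le \<and> ?eq" ..
  next
    assume *: "?le \<and> ?eq"
    then obtain a b where ab: "(a, - e * b) \<in> D"
      "dist (x, e * y) (0, e) = dist (x, e * y) (a, - e * b)"
      using eq by blast
    have "dist (x, e * y) (0, e) \<le> dist (x, e * y) w" if "w \<in> D" for w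
    proof -
      have "w = (fst w, - e * (- e * snd w))" by (simp add: e')
      then obtain a b where "w = (a, - e * b)" by blast
      then show ?thesis using * that le by simp
    qed
    then have "dist (x, e * y) (0, e) \<le> infdist (x, e * y) D"
      using \<open>D \<noteq> {}\<close> by (simp add: infdist_def cINF_greatest)
    moreover have "infdist (x, e * y) D \<le> dist (x, e * y) (0, e)"
      using infdist_le[OF ab(1)] ab(2) by simp
    ultimately show "(x, e * y) \<in> C" by (simp add: C)
  qed
qed

text \<open>
  On the vertical line through $x$ the comparison with each point of \<open>D\<close> is an
  affine condition on $y$ with slope at least $2$, since \<open>D\<close> lies strictly on the
  other side of the axis. This forces uniqueness. For existence one finds points of both signs:
  a value of $y$ at which a chosen point of \<open>D\<close> is as near as $(0, e)$, and $(1 +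
  x^2) / 2$, which is large enough for every point of \<open>D\<close>.
\<close>

lemma curve_is_graph:
  fixes C D :: "(real \<times> real) set" and e :: real
  assumes C: "C = {z. dist z (0, e) = infdist z D}" and D: "D = {z. dist z (0, -e) = infdist z C}"
    and ne: "D \<noteq> {}" "(0, e) \<notin> D" and e: "e * e = 1"
  shows "\<exists>!y. (x, e * y) \<in> C"
proof -
  have "closed D" unfolding D by (rule closed_equidistant)
  note cond = curve_point_condition[OF C this ne(1) e]
  have e': "e * (e * t) = t" for t by (simp add: e flip: mult.assoc)
  have b_pos: "0 < b" if "(a, - e * b) \<in> D" for a b
    using opposite_side[OF C D ne that] by (simp add: e')
  show ?thesis
  proof (rule ex_ex1I)
    define \<phi> where "\<phi> y = infdist (x, e * y) D - dist (x, e * y) (0, e)" for y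
    have "continuous_on UNIV \<phi>" unfolding \<phi>_def by (intro continuous_intros)
    have le: "dist (x, e * y) (0, e) \<le> dist (x, e * y) (a, - e * b) \<longleftrightarrow>
        1 + 2 * a * x - a\<^sup>2 - b\<^sup>2 \<le> 2 * y * (1 + b)" for a b y
      by (simp add: dist_le_iff_squares power2_eq_square algebra_simps e e')
    obtain w where "w \<in> D" using ne by blast
    moreover have "w = (fst w, - e * (- e * snd w))" by (simp add: e')
    ultimately obtain a b where ab: "(a, - e * b) \<in> D" by metis
    define y0 where "y0 = (1 + 2 * a * x - a\<^sup>2 - b\<^sup>2) / (2 * (1 + b))"
    have "2 * y0 * (1 + b) = 1 + 2 * a * x - a\<^sup>2 - b\<^sup>2"
      using b_pos[OF ab] by (simp add: y0_def field_simps)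
    then have "dist (x, e * y0) (0, e) = dist (x, e * y0) (a, - e * b)"
      by (simp add: dist_eq_iff_squares power2_eq_square algebra_simps e e')
    then have low: "\<phi> y0 \<le> 0" using infdist_le[OF ab, of "(x, e * y0)"] by (simp add: \<phi>_def)
    define y1 where "y1 = (1 + x\<^sup>2) / 2"
    have "dist (x, e * y1) (0, e) \<le> dist (x, e * y1) w" if "w \<in> D" for w
    proof -
      obtain a b where w: "w = (a, - e * b)" using e' by (metis minus_mult_minus prod.collapse)
      have b: "0 < b" using b_pos that w by blast
      have "0 \<le> (a - x)\<^sup>2 + b\<^sup>2 + (1 + x\<^sup>2) * b" using b by (intro add_nonneg_nonneg) auto
      also have "\<dots> = 2 * y1 * (1 + b) - (1 + 2 * a * x - a\<^sup>2 - b\<^sup>2)"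
        unfolding y1_def by (simp add: power2_eq_square algebra_simps)
      finally show ?thesis unfolding w le by simp
    qed
    then have high: "0 \<le> \<phi> y1"
      using ne by (simp add: \<phi>_def infdist_def cINF_greatest)
    have "connected (range \<phi>)"
      by (rule connected_continuous_image[OF \<open>continuous_on UNIV \<phi>\<close> connected_UNIV])
    then have "0 \<in> range \<phi>" using low high by (meson connectedD_interval rangeI)
    then obtain y where "\<phi> y = 0" by auto
    then have "(x, e * y) \<in> C" by (simp add: C \<phi>_def)
    then show "\<exists>y. (x, e * y) \<in> C" ..
  next
    have ordered: "\<not> y < y'" if mem: "(x, e * y) \<in> C" "(x, e * y') \<in> C" for y y'
    proof
      assume "y < y'"
      obtain a b where ab: "(a, - e * b) \<in> D" "2 * y' * (1 + b) = 1 + 2 * a * x - a\<^sup>2 - b\<^sup>2"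
        using mem(2) unfolding cond by blast
      then have "2 * y' * (1 + b) \<le> 2 * y * (1 + b)" using mem(1) ab(1) unfolding cond by auto
      moreover have "2 * y * (1 + b) < 2 * y' * (1 + b)"
        using \<open>y < y'\<close> b_pos[OF ab(1)] by (intro mult_strict_right_mono) auto
      ultimately show False by simp
    qed
    show "y = y'" if "(x, e * y) \<in> C" "(x, e * y') \<in> C" for y y'
      using ordered that by (meson linorder_neqE)
  qed
qed

theorem trisector_curves_are_graphs:
  assumes "distance_trisector_curves (0, 1) (0, -1) C D"
  obtains f g where "trisector_pair f g" "C = {(x, f x) | x. True}"
proof -
  have C: "C = {z. dist z (0, 1) = infdist z D}" and D: "D = {z. dist z (0, -1) = infdist z C}"
    and ne: "C \<noteq> {}" "D \<noteq> {}" and pq: "(0, 1) \<notin> D" "(0, -1) \<notin> C"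
    using assms unfolding distance_trisector_curves_def plane_curve_def separates_def
    by (blast, blast, blast, blast, blast, blast)
  have D': "D = {z. dist z (0, - 1) = infdist z C}" using D by simp
  have C': "C = {z. dist z (0, - (- 1)) = infdist z D}" using C by simp
  have ex1: "\<exists>!y. (x, 1 * y) \<in> C" for x by (rule curve_is_graph[OF C D' ne(2) pq(1)]) simp
  have ex1': "\<exists>!y. (x, - 1 * y) \<in> D" for x by (rule curve_is_graph[OF D' C' ne(1) pq(2)]) simp
  define f where "f x = (THE y. (x, 1 * y) \<in> C)" for x
  define g where "g x = (THE y. (x, - 1 * y) \<in> D)" for x
  have f: "(x, y) \<in> C \<longleftrightarrow> y = f x" for x y
    using theI'[OF ex1[of x]] ex1[of x] unfolding f_def by auto
  have g: "(x, - y) \<in> D \<longleftrightarrow> y = g x" for x y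
    using theI'[OF ex1'[of x]] ex1'[of x] unfolding g_def by auto
  have "closed C" "closed D" by (subst C D, rule closed_equidistant)+
  note cond = curve_point_condition[OF C \<open>closed D\<close> ne(2), simplified, unfolded f g]
    curve_point_condition[OF D' \<open>closed C\<close> ne(1), simplified, unfolded f g]
  have "trisector_pair f g"
  proof
    fix x a
    show "0 < f x" using opposite_side[OF D' C' ne(1) pq(2), of "(x, f x)"] f by simp
    show "0 < g x" using opposite_side[OF C D' ne(2) pq(1), of "(x, - g x)"] g by simp
    show "1 + 2 * a * x - a\<^sup>2 - (g a)\<^sup>2 \<le> 2 * f x * (1 + g a)" using cond(1)[where x = x and y = "f x"] by simp
    show "1 + 2 * a * x - a\<^sup>2 - (f a)\<^sup>2 \<le> 2 * g x * (1 + f a)" using cond(2)[where x = x and y = "g x"] by simp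
    show "\<exists>a. foot f g x a" using cond(1)[where x = x and y = "f x"] by (auto simp: foot_def)
    show "\<exists>a. foot g f x a" using cond(2)[where x = x and y = "g x"] by (auto simp: foot_def)
  qed
  moreover have "C = {(x, f x) | x. True}" using f by auto
  ultimately show thesis by (rule that)
qed

section \<open>Convexity, tangents and normals\<close>

context trisector_pair
begin

lemma swap: "trisector_pair g f"
  using f_pos g_pos f_above g_above foot_in_g foot_in_f by unfold_locales

text \<open>
  The points of the other curve over $1$ and $-1$ alone already push $g$ above two lines with
  slopes of opposite signs, so $g$ grows at least linearly. This bounds the slopes $a / (1 +
  g(a))$ of all supporting lines of $f$.
\<close>

lemma slope_bounded:
  obtains K where "K > 0" "\<And>a. \<bar>a\<bar> \<le> K * (1 + g a)"
proof
  define K where "K = 2 + f 1 + f (-1) + (f 1)\<^sup>2 + (f (-1))\<^sup>2"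
  show "K > 0" using f_pos[of 1] f_pos[of "-1"] by (auto simp: K_def intro!: add_pos_nonneg)
  fix a
  have "2 * a - (f 1)\<^sup>2 \<le> 2 * g a * (1 + f 1)" using g_above[of 1 a] by simp
  moreover have "- 2 * a - (f (-1))\<^sup>2 \<le> 2 * g a * (1 + f (-1))" using g_above[of "-1" a] by simp
  moreover have "2 * g a * (1 + f 1) \<le> 2 * g a * K" "2 * g a * (1 + f (-1)) \<le> 2 * g a * K"
    using g_pos[of a] f_pos[of 1] f_pos[of "-1"]
    by (auto simp: K_def intro!: mult_left_mono add_increasing)
  moreover have "(f 1)\<^sup>2 \<le> K" "(f (-1))\<^sup>2 \<le> K"
    using f_pos[of 1] f_pos[of "-1"] by (auto simp: K_def)
  moreover have "K * (1 + g a) = K + g a * K" by algebra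
  ultimately show "\<bar>a\<bar> \<le> K * (1 + g a)" using \<open>K > 0\<close> by linarith
qed

lemma foot_subgradient:
  assumes "foot f g x a"
  shows "f x + a / (1 + g a) * (y - x) \<le> f y"
proof -
  have "2 * (f x * (1 + g a) + a * (y - x)) \<le> 2 * (f y * (1 + g a))"
    using f_above[of a y] assms by (simp add: foot_def algebra_simps)
  then have "(f x * (1 + g a) + a * (y - x)) / (1 + g a) \<le> f y"
    using g_pos[of a] by (simp add: pos_divide_le_eq)
  moreover have "(f x * (1 + g a) + a * (y - x)) / (1 + g a) = f x + a / (1 + g a) * (y - x)"
    using g_pos[of a] by (simp add: add_divide_distrib)
  ultimately show ?thesis by simp
qed

lemma lipschitz:
  obtains K where "K > 0" "\<And>x y. \<bar>f x - f y\<bar> \<le> K * \<bar>x - y\<bar>" "\<And>a. \<bar>a / (1 + g a)\<bar> \<le> K"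
proof -
  obtain K where K: "K > 0" "\<And>a. \<bar>a\<bar> \<le> K * (1 + g a)" using slope_bounded by metis
  have slope: "\<bar>a / (1 + g a)\<bar> \<le> K" for a
    using K(2)[of a] g_pos[of a] by (simp add: abs_divide pos_divide_le_eq)
  have one_sided: "f x - f y \<le> K * \<bar>x - y\<bar>" for x y
  proof -
    obtain a where "foot f g x a" using foot_in_g by blast
    then have "f x - f y \<le> a / (1 + g a) * (x - y)"
      using foot_subgradient[of x a y] minus_mult_right[of "a / (1 + g a)" "y - x"] by simp
    also have "\<dots> \<le> \<bar>a / (1 + g a)\<bar> * \<bar>x - y\<bar>" by (metis abs_ge_self abs_mult)
    also have "\<dots> \<le> K * \<bar>x - y\<bar>" using slope by (intro mult_right_mono) auto
    finally show ?thesis .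
  qed
  have "\<bar>f x - f y\<bar> \<le> K * \<bar>x - y\<bar>" for x y
    using one_sided[of x y] one_sided[of y x] by (simp add: abs_minus_commute abs_le_iff)
  then show thesis using that K(1) slope by blast
qed

lemma convex_combination:
  assumes "0 \<le> t" "t \<le> 1"
  shows "f (a + t * (b - a)) \<le> f a + t * (f b - f a)"
proof -
  define c where "c = a + t * (b - a)"
  obtain d where "foot f g c d" using foot_in_g by blast
  define m where "m = d / (1 + g d)"
  have "f c + m * (a - c) \<le> f a" "f c + m * (b - c) \<le> f b"
    using foot_subgradient[OF \<open>foot f g c d\<close>] by (auto simp: m_def)
  then have "(1 - t) * (f c + m * (a - c)) + t * (f c + m * (b - c)) \<le> (1 - t) * f a + t * f b"
    using assms by (intro add_mono mult_left_mono) auto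
  moreover have "(1 - t) * (f c + m * (a - c)) + t * (f c + m * (b - c))
      = f c + m * (a + t * (b - a) - c)"
    by (simp add: algebra_simps)
  ultimately show ?thesis by (simp add: c_def algebra_simps)
qed

text \<open>
  First-order optimality of the nearest point: moving from $a$ a little towards $b$ does not
  decrease the distance to $(x, f(x))$, and convexity of $g$ turns this into a supporting line
  of the other curve at the foot that is orthogonal to the segment from $(x, f(x))$ to its foot.
\<close>

lemma normal_subgradient:
  assumes foot: "foot f g x a"
  shows "(f x + g a) * (g b - g a) \<ge> (b - a) * (x - a)"
proof (rule ccontr)
  define S where "S = f x + g a"
  define \<Delta> where "\<Delta> = g b - g a"
  define \<delta> where "\<delta> = b - a"
  define \<alpha> where "\<alpha> = \<delta> * (x - a) - S * \<Delta>"
  assume "\<not> ?thesis"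
  then have \<alpha>: "\<alpha> > 0" by (simp add: \<alpha>_def S_def \<Delta>_def \<delta>_def)
  have bound: "2 * \<alpha> \<le> t * (\<delta>\<^sup>2 + \<Delta>\<^sup>2)" if t: "0 < t" "t \<le> 1" for t
  proof -
    define c where "c = a + t * \<delta>"
    have "g c \<le> g a + t * \<Delta>"
      using trisector_pair.convex_combination[OF swap, of t a b] t
      by (simp add: c_def \<delta>_def \<Delta>_def)
    then have "(f x + g c)\<^sup>2 \<le> (S + t * \<Delta>)\<^sup>2"
      using f_pos[of x] g_pos[of c] by (intro power_mono) (auto simp: S_def)
    moreover have "(x - a)\<^sup>2 + S\<^sup>2 \<le> (x - c)\<^sup>2 + (f x + g c)\<^sup>2"
      using f_above[of c x] foot by (simp add: foot_def S_def power2_eq_square algebra_simps)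
    ultimately have "0 \<le> (x - c)\<^sup>2 + (S + t * \<Delta>)\<^sup>2 - ((x - a)\<^sup>2 + S\<^sup>2)" by simp
    also have "\<dots> = t * (t * (\<delta>\<^sup>2 + \<Delta>\<^sup>2) - 2 * \<alpha>)"
      unfolding c_def \<alpha>_def by (simp add: power2_eq_square algebra_simps)
    finally show ?thesis using t by (simp add: zero_le_mult_iff)
  qed
  \<comment> \<open>The inequality fails for a step length below the ratio of the two sides.\<close>
  define W where "W = \<delta>\<^sup>2 + \<Delta>\<^sup>2"
  have W: "W > 0" using bound[of 1] \<alpha> by (simp add: W_def)
  have "2 * \<alpha> \<le> min 1 (\<alpha> / W) * W"
    using bound[of "min 1 (\<alpha> / W)"] \<alpha> W by (simp add: W_def)
  also have "\<dots> \<le> \<alpha> / W * W" using W by (intro mult_right_mono) auto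
  finally show False using \<alpha> W by simp
qed

text \<open>
  The nearest point is unique in a quantitative way, because the squared distance to $(x, f(x))$
  is strongly convex along the convex curve.
\<close>

lemma foot_quadratic_gap:
  assumes "foot f g x a"
  shows "(b - a)\<^sup>2 \<le> 2 * f x * (1 + g b) - (1 + 2 * b * x - b\<^sup>2 - (g b)\<^sup>2)"
proof -
  have "2 * f x * (1 + g b) - (1 + 2 * b * x - b\<^sup>2 - (g b)\<^sup>2)
      = (b - a)\<^sup>2 + (g b - g a)\<^sup>2 + 2 * ((f x + g a) * (g b - g a) - (b - a) * (x - a))"
    using assms by (simp add: foot_def power2_eq_square algebra_simps)
  then show ?thesis using normal_subgradient[OF assms, of b] by simp
qed

text \<open>
  A supremum of affine functions is differentiable where the maximiser is unique and stable.
  Here the loss incurred by an index $b$ other than the foot $a$ is at least quadratic in $b -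
  a$, whereas its gain at $x + h$ is at most of order $h (b - a)$; so the maximum lies above its
  supporting line by $O(h^2)$ only.
\<close>

lemma has_derivative_foot:
  assumes foot: "foot f g x a"
  shows "(f has_real_derivative a / (1 + g a)) (at x)"
proof -
  define m where "m = a / (1 + g a)"
  have m: "m * (1 + g a) = a" using g_pos[of a] by (simp add: m_def)
  obtain K where K: "K > 0" "\<And>x y. \<bar>g x - g y\<bar> \<le> K * \<bar>x - y\<bar>"
    using trisector_pair.lipschitz[OF swap] by metis
  define M where "M = \<bar>m\<bar> * K + 1"
  have upper: "f (x + h) \<le> f x + m * h + M\<^sup>2 * h\<^sup>2 / 2" for h
  proof -
    obtain b where b: "foot f g (x + h) b" using foot_in_g by blast
    have "\<bar>m * (g b - g a) - (b - a)\<bar> \<le> \<bar>m\<bar> * \<bar>g b - g a\<bar> + \<bar>b - a\<bar>"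
      by (metis abs_mult abs_triangle_ineq4)
    also have "\<dots> \<le> \<bar>m\<bar> * (K * \<bar>b - a\<bar>) + \<bar>b - a\<bar>"
      using K(2)[of b a] by (intro add_mono mult_left_mono) auto
    also have "\<dots> = M * \<bar>b - a\<bar>" by (simp add: M_def algebra_simps)
    finally have "\<bar>h\<bar> * \<bar>m * (g b - g a) - (b - a)\<bar> \<le> \<bar>h\<bar> * (M * \<bar>b - a\<bar>)"
      by (rule mult_left_mono) auto
    then have "- (\<bar>h\<bar> * (M * \<bar>b - a\<bar>)) \<le> h * (m * (g b - g a) - (b - a))"
      by (metis abs_ge_minus_self abs_mult minus_le_iff order_trans)
    moreover have "0 \<le> (\<bar>b - a\<bar> - M * \<bar>h\<bar>)\<^sup>2" by simp
    then have "2 * (\<bar>h\<bar> * (M * \<bar>b - a\<bar>)) \<le> (b - a)\<^sup>2 + M\<^sup>2 * h\<^sup>2"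
      by (simp add: power2_eq_square algebra_simps)
    ultimately have "- (M\<^sup>2 * h\<^sup>2) \<le> (b - a)\<^sup>2 + 2 * h * (m * (g b - g a) - (b - a))" by simp
    also have "\<dots> \<le> 2 * f x * (1 + g b) - (1 + 2 * b * x - b\<^sup>2 - (g b)\<^sup>2)
        + 2 * h * (m * (g b - g a) - (b - a))"
      using foot_quadratic_gap[OF foot, of b] by simp
    also have "\<dots> = 2 * (1 + g b) * (f x + m * h - f (x + h)) + 2 * h * (a - m * (1 + g a))"
      using b by (simp add: foot_def algebra_simps)
    also have "\<dots> = 2 * (1 + g b) * (f x + m * h - f (x + h))" by (simp add: m)
    finally have *: "2 * (1 + g b) * (f (x + h) - (f x + m * h)) \<le> M\<^sup>2 * h\<^sup>2"
      by (simp add: algebra_simps)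
    show ?thesis
    proof (cases "f (x + h) - (f x + m * h) \<le> 0")
      case True
      have "0 \<le> M\<^sup>2 * h\<^sup>2 / 2" by simp
      with True show ?thesis by linarith
    next
      case False
      then have "2 * (f (x + h) - (f x + m * h)) \<le> 2 * (1 + g b) * (f (x + h) - (f x + m * h))"
        using g_pos[of b] by (intro mult_right_mono) auto
      with * show ?thesis by simp
    qed
  qed
  have lower: "f x + m * h \<le> f (x + h)" for h
    using foot_subgradient[OF foot, of "x + h"] by (simp add: m_def)
  have "(\<lambda>h. (f (x + h) - f x) / h) \<midarrow>0\<rightarrow> m"
  proof (rule LIM_zero_cancel, rule Lim_null_comparison)
    show "\<forall>\<^sub>F h in at 0. norm ((f (x + h) - f x) / h - m) \<le> M\<^sup>2 / 2 * \<bar>h\<bar>"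
    proof (rule eventually_at_filter[THEN iffD2], rule always_eventually, intro allI impI)
      fix h :: real assume "h \<noteq> 0"
      have "\<bar>f (x + h) - f x - m * h\<bar> \<le> M\<^sup>2 / 2 * h\<^sup>2" using upper[of h] lower[of h] by simp
      moreover have "(f (x + h) - f x) / h - m = (f (x + h) - f x - m * h) / h"
        using \<open>h \<noteq> 0\<close> by (simp add: field_simps)
      ultimately show "norm ((f (x + h) - f x) / h - m) \<le> M\<^sup>2 / 2 * \<bar>h\<bar>"
        using \<open>h \<noteq> 0\<close> by (simp add: abs_divide pos_divide_le_eq power2_eq_square mult.assoc)
    qed
    show "(\<lambda>h. M\<^sup>2 / 2 * \<bar>h\<bar>) \<midarrow>0\<rightarrow> 0" by (auto intro!: tendsto_eq_intros)
  qed
  then show ?thesis by (simp add: DERIV_def m_def)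
qed

end

text \<open>
  The input is a point $(x, y)$ with a slope $p$ there; its reflection $(x, -y)$, with slope
  $-p$, is thought of as lying on the other curve. The output is the point on the normal at $(x,
  -y)$ that has equal distances from $(x, -y)$ and $(0, 1)$, with the slope of the perpendicular
  bisector of these two points.
\<close>

fun advance :: "real \<times> real \<times> real \<Rightarrow> real \<times> real \<times> real"
  where "advance (x, y, p) =
    (let s = (x\<^sup>2 + (1 + y)\<^sup>2) / (2 * (1 + y - x * p)) in (x + s * p, s - y, x / (1 + y)))"

text \<open>
  The denominators of \<open>advance\<close>: the point is not on the horizontal line through
  $(0, -1)$, and its tangent does not pass through $(0, -1)$.
\<close>

fun regular :: "real \<times> real \<times> real \<Rightarrow> bool"
  where "regular (x, y, p) \<longleftrightarrow> 1 + y \<noteq> 0 \<and> 1 + y - x * p \<noteq> 0"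

definition regular_orbit :: "nat \<Rightarrow> real \<times> real \<times> real \<Rightarrow> bool"
  where "regular_orbit k v \<longleftrightarrow> (\<forall>i<k. regular ((advance ^^ i) v))"

abbreviation on_curve :: "real poly poly \<Rightarrow> real \<times> real \<times> real \<Rightarrow> bool"
  where "on_curve Q v \<equiv> poly_xy Q (fst v) (fst (snd v)) = 0"

definition jet :: "(real \<Rightarrow> real) \<Rightarrow> real \<Rightarrow> real \<times> real \<times> real"
  where "jet f x = (x, f x, deriv f x)"

context trisector_pair
begin

lemma deriv_foot: "foot f g x a \<Longrightarrow> deriv f x = a / (1 + g a)"
  by (rule DERIV_imp_deriv) (rule has_derivative_foot)

lemma differentiable: "(f has_real_derivative deriv f x) (at x)"
  using foot_in_g[of x] has_derivative_foot deriv_foot by metis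

lemma tangent_below: "f x + deriv f x * (y - x) \<le> f y"
  using foot_in_g[of x] foot_subgradient deriv_foot by metis

text \<open>
  The supporting line in \<open>normal_subgradient\<close> is the tangent, so the segment from
  $(x, f(x))$ to its foot is normal to the other curve.
\<close>

lemma normal_eq_deriv:
  assumes "foot f g x a"
  shows "x - a = (f x + g a) * deriv g a"
proof -
  have pos: "f x + g a > 0" using f_pos g_pos by (simp add: add_pos_pos)
  define \<phi> where "\<phi> b = (f x + g a) * (g b - g a) - (b - a) * (x - a)" for b
  have "(\<phi> has_real_derivative (f x + g a) * deriv g a - (x - a)) (at a)"
    unfolding \<phi>_def
    by (auto intro!: derivative_eq_intros trisector_pair.differentiable[OF swap])
  moreover have "\<phi> a \<le> \<phi> b" for b using normal_subgradient[OF assms, of b] by (simp add: \<phi>_def)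
  ultimately have "(f x + g a) * deriv g a - (x - a) = 0"
    by (intro DERIV_local_min[OF _ zero_less_one]) auto
  then show ?thesis by simp
qed

lemma advance_foot:
  assumes foot: "foot f g x a"
  shows "regular (jet g a)" "advance (jet g a) = jet f x"
proof -
  have normal: "x = a + (f x + g a) * deriv g a" using normal_eq_deriv[OF foot] by simp
  have g1: "1 + g a \<noteq> 0" using g_pos[of a] by simp
  have "2 * (f x + g a) * (1 + g a - a * deriv g a)
      = 2 * f x * (1 + g a) + 2 * g a * (1 + g a) - 2 * a * ((f x + g a) * deriv g a)"
    by (simp add: algebra_simps)
  also have "\<dots> = 2 * f x * (1 + g a) + 2 * g a * (1 + g a) - 2 * a * (x - a)"
    using normal_eq_deriv[OF foot] by simp
  also have "\<dots> = a\<^sup>2 + (1 + g a)\<^sup>2"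
    using foot by (simp add: foot_def power2_eq_square algebra_simps)
  finally have s: "2 * (f x + g a) * (1 + g a - a * deriv g a) = a\<^sup>2 + (1 + g a)\<^sup>2" .
  moreover have "a\<^sup>2 + (1 + g a)\<^sup>2 > 0" using g1 by (simp add: add_nonneg_pos)
  ultimately have D: "1 + g a - a * deriv g a \<noteq> 0" by auto
  then show "regular (jet g a)" using g1 by (simp add: jet_def)
  have "(a\<^sup>2 + (1 + g a)\<^sup>2) / (2 * (1 + g a - a * deriv g a)) = f x + g a"
  proof -
    have "a\<^sup>2 + (1 + g a)\<^sup>2 = (f x + g a) * (2 * (1 + g a - a * deriv g a))"
      unfolding s[symmetric] by (simp only: mult_ac)
    then show ?thesis using D by simp
  qed
  then show "advance (jet g a) = jet f x"
    using normal by (simp add: jet_def deriv_foot[OF foot])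
qed

text \<open>
  Only after two steps does one return to the same curve, which is the one with a polynomial
  equation.
\<close>

lemma double_foot:
  "\<exists>b. regular (jet f b) \<and> regular (advance (jet f b)) \<and> (advance ^^ 2) (jet f b) = jet f x"
proof -
  obtain a where a: "foot f g x a" using foot_in_g by blast
  obtain b where b: "foot g f a b" using foot_in_f by blast
  show ?thesis
    using advance_foot[OF a] trisector_pair.advance_foot[OF swap b]
    by (intro exI[of _ b]) (simp add: numeral_2_eq_2)
qed

text \<open>
  A tangent line determines the reflection of $(0, 1)$ in it, which is the foot, and the foot
  determines the point. Two points with equal slopes on a convex curve have the same tangent
  line.
\<close>

lemma equal_slopes_imp_same_point:
  assumes x: "foot f g x a" and y: "foot f g y b" and eq: "deriv f x = deriv f y"
  shows "x = y"
proof -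
  define m where "m = deriv f x"
  have "c = deriv f z * (1 + g c)" if "foot f g z c" for z c
    using deriv_foot[OF that] g_pos[of c] by simp
  from this[OF x] this[OF y] have slope: "a = m * (1 + g a)" "b = m * (1 + g b)"
    by (simp_all add: m_def eq)
  have intercept: "2 * (f z - m * z) = 2 - (1 + g c) * (1 + m\<^sup>2)"
    if "foot f g z c" "c = m * (1 + g c)" for z c
  proof -
    have "(1 + g c) * (2 * (f z - m * z)) = 2 * f z * (1 + g c) - 2 * (m * (1 + g c)) * z"
      by (simp add: algebra_simps)
    also have "\<dots> = 2 * f z * (1 + g c) - 2 * c * z" using that(2) by simp
    also have "\<dots> = 1 - c\<^sup>2 - (g c)\<^sup>2" using that(1) by (simp add: foot_def)
    also have "\<dots> = 1 - (m * (1 + g c))\<^sup>2 - (g c)\<^sup>2" using that(2) by simp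
    also have "\<dots> = (1 + g c) * (2 - (1 + g c) * (1 + m\<^sup>2))"
      by (simp add: power2_eq_square algebra_simps)
    finally show ?thesis using g_pos[of c] by simp
  qed
  \<comment> \<open>Both tangents support the graph from below, so parallel ones coincide.\<close>
  have "f x - m * x = f y - m * y"
    using tangent_below[of x y] tangent_below[of y x] eq by (simp add: m_def algebra_simps)
  then have "g a = g b"
    using intercept[OF x slope(1)] intercept[OF y slope(2)] by (simp add: add_nonneg_eq_0_iff)
  then have "a = b" using slope by metis
  then have "jet f x = jet f y" using advance_foot(2)[OF x] advance_foot(2)[OF y] by simp
  then show ?thesis by (simp add: jet_def)
qed

lemma deriv_inj: "deriv f x = deriv f y \<Longrightarrow> x = y"
  using foot_in_g[of x] foot_in_g[of y] equal_slopes_imp_same_point by blast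

end

section \<open>The asymptote\<close>

context trisector_pair
begin

lemma deriv_mono: "x \<le> y \<Longrightarrow> deriv f x \<le> deriv f y"
proof (cases "x = y")
  case False
  assume "x \<le> y"
  have "deriv f x * (y - x) \<le> deriv f y * (y - x)"
    using tangent_below[of x y] tangent_below[of y x] by (simp add: algebra_simps)
  then show ?thesis using False \<open>x \<le> y\<close> by (simp add: mult_le_cancel_right)
qed simp

text \<open>
  The slope increases by convexity and is bounded; its limit is positive because $f$ grows at
  least linearly.
\<close>

lemma asymptotic_slope:
  "\<exists>\<kappa>>0. (\<forall>x. deriv f x \<le> \<kappa>) \<and> (deriv f \<longlongrightarrow> \<kappa>) at_top \<and> ((\<lambda>x. f x / x) \<longlongrightarrow> \<kappa>) at_top"
proof -
  obtain K where K: "\<And>a. \<bar>a / (1 + g a)\<bar> \<le> K" using lipschitz by metis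
  have "deriv f x \<le> K" for x
    using foot_in_g[of x] K deriv_foot abs_le_D1 by metis
  then have bdd: "bdd_above (range (deriv f))" by (intro bdd_aboveI) auto
  define \<kappa> where "\<kappa> = (SUP x. deriv f x)"
  have le: "deriv f x \<le> \<kappa>" for x unfolding \<kappa>_def by (intro cSUP_upper bdd) auto
  have lim: "(deriv f \<longlongrightarrow> \<kappa>) at_top"
  proof (rule increasing_tendsto)
    fix c assume "c < \<kappa>"
    obtain x where "c < deriv f x" using \<open>c < \<kappa>\<close> unfolding \<kappa>_def using less_cSUP_iff[OF _ bdd] by auto
    show "\<forall>\<^sub>F y in at_top. c < deriv f y"
      using eventually_ge_at_top[of x]
    proof eventually_elim
      case (elim y)
      then show ?case using \<open>c < deriv f x\<close> deriv_mono[of x y] by simp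
    qed
  qed (use le in simp)
  have "\<kappa> > 0"
  proof (rule ccontr)
    assume "\<not> \<kappa> > 0"
    obtain L where L: "L > 0" "\<And>a. \<bar>a\<bar> \<le> L * (1 + f a)"
      using trisector_pair.slope_bounded[OF swap] by metis
    define x where "x = L * (1 + f 0) + 1"
    have x: "x > 0" using L(1) f_pos[of 0] by (simp add: x_def add_pos_pos)
    have "f x \<le> f 0"
    proof -
      have "f x - deriv f x * x \<le> f 0" using tangent_below[of x 0] by simp
      moreover have "deriv f x * x \<le> 0"
        using \<open>\<not> \<kappa> > 0\<close> le[of x] x by (intro mult_nonpos_nonneg) auto
      ultimately show ?thesis by simp
    qed
    then have "L * (1 + f x) \<le> L * (1 + f 0)" using L(1) by simp
    with L(2)[of x] x show False by (simp add: x_def)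
  qed
  moreover have "((\<lambda>x. f x / x) \<longlongrightarrow> \<kappa>) at_top"
  proof (rule tendsto_sandwich)
    \<comment> \<open>The tangent at the square root of x: its slope still tends to the limit, and its point of contact is negligible against x.\<close>
    show "\<forall>\<^sub>F x in at_top. deriv f (sqrt x) * (1 - sqrt x / x) \<le> f x / x"
      using eventually_gt_at_top[of 0]
    proof eventually_elim
      case (elim x)
      have "deriv f (sqrt x) * (x - sqrt x) \<le> f x"
        using tangent_below[of "sqrt x" x] f_pos[of "sqrt x"] by linarith
      then have "deriv f (sqrt x) * (x - sqrt x) / x \<le> f x / x"
        using elim by (intro divide_right_mono) auto
      moreover have "deriv f (sqrt x) * (x - sqrt x) / x = deriv f (sqrt x) * (1 - sqrt x / x)"
        using elim by (simp add: field_simps)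
      ultimately show ?case by simp
    qed
    show "\<forall>\<^sub>F x in at_top. f x / x \<le> deriv f x + f 0 / x"
      using eventually_gt_at_top[of 0]
    proof eventually_elim
      case (elim x)
      have "f x \<le> deriv f x * x + f 0" using tangent_below[of x 0] by simp
      then show ?case using elim by (simp add: field_simps)
    qed
    have "((\<lambda>x. 1 / sqrt x) \<longlongrightarrow> 0) at_top"
      by (intro tendsto_divide_0[OF tendsto_const] filterlim_at_top_imp_at_infinity sqrt_at_top)
    moreover have "\<forall>\<^sub>F x in at_top. 1 / sqrt x = sqrt x / x"
      using eventually_gt_at_top[of 0] by eventually_elim (simp add: field_simps)
    ultimately have "((\<lambda>x. sqrt x / x) \<longlongrightarrow> 0) at_top" by (rule Lim_transform_eventually)
    moreover have "((\<lambda>x. deriv f (sqrt x)) \<longlongrightarrow> \<kappa>) at_top"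
      by (rule filterlim_compose[OF lim sqrt_at_top])
    ultimately have "((\<lambda>x. deriv f (sqrt x) * (1 - sqrt x / x)) \<longlongrightarrow> \<kappa> * (1 - 0)) at_top"
      by (intro tendsto_intros)
    then show "((\<lambda>x. deriv f (sqrt x) * (1 - sqrt x / x)) \<longlongrightarrow> \<kappa>) at_top" by simp
    have "((\<lambda>x. deriv f x + f 0 / x) \<longlongrightarrow> \<kappa> + 0) at_top"
      by (intro tendsto_intros lim tendsto_divide_0[OF tendsto_const] filterlim_at_top_imp_at_infinity filterlim_ident)
    then show "((\<lambda>x. deriv f x + f 0 / x) \<longlongrightarrow> \<kappa>) at_top" by simp
  qed
  ultimately show ?thesis using le lim by blast
qed

text \<open>
  The tangent at $(x, f(x))$ passes through $(0, -1)$ if and only if the expression vanishes. By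
  convexity two such tangents on the same side would be equal, so there is at most one.
\<close>

lemma tangent_misses_opposite_point: "\<forall>\<^sub>F x in at_top. 1 + f x - x * deriv f x \<noteq> 0"
proof -
  have unique: "x = y" if "0 < x" "0 < y" "1 + f x - x * deriv f x = 0" "1 + f y - y * deriv f y = 0" for x y
  proof (rule deriv_inj)
    have "y * deriv f x \<le> y * deriv f y" "x * deriv f y \<le> x * deriv f x"
      using tangent_below[of x y] tangent_below[of y x] that(3,4) by (simp_all add: algebra_simps)
    then show "deriv f x = deriv f y" using that(1,2) by simp
  qed
  show ?thesis
  proof (cases "\<exists>x>0. 1 + f x - x * deriv f x = 0")
    case True
    then obtain x where "x > 0" "1 + f x - x * deriv f x = 0" by blast
    then have *: "1 + f y - y * deriv f y \<noteq> 0" if "y > x" for y using unique[of x y] that by auto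
    show ?thesis using eventually_gt_at_top[of x] by (rule eventually_mono) (rule *)
  next
    case False
    then have *: "1 + f y - y * deriv f y \<noteq> 0" if "y > 0" for y using that by blast
    show ?thesis using eventually_gt_at_top[of 0] by (rule eventually_mono) (rule *)
  qed
qed

text \<open>
  The first factor compares $f$ with the line of slope $\kappa$ through $(0, -1)$, the second
  says on which side of $(0, -1)$ the tangent meets the axis. If no tangent at a positive
  abscissa passes below $(0, -1)$, then $f$ lies above all lines through that point with slopes
  $f'(t)$, $t > 0$, hence above their limit. Once a tangent passes below, all later ones do, and
  the first factor is at most the second.
\<close>

lemma asymptote_side:
  assumes le: "\<And>x. deriv f x \<le> \<kappa>" and lim: "(deriv f \<longlongrightarrow> \<kappa>) at_top"
  shows "\<forall>\<^sub>F x in at_top. 0 \<le> (1 + f x - \<kappa> * x) * (1 + f x - x * deriv f x)"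
proof (cases "\<forall>t>0. 0 \<le> 1 + f t - t * deriv f t")
  case True
  have "0 \<le> 1 + f x - \<kappa> * x" for x
  proof -
    have "((\<lambda>t. 1 + f x - deriv f t * x) \<longlongrightarrow> 1 + f x - \<kappa> * x) at_top"
      by (intro tendsto_intros lim)
    moreover have "\<forall>\<^sub>F t in at_top. 0 \<le> 1 + f x - deriv f t * x"
      using eventually_gt_at_top[of 0]
    proof eventually_elim
      case (elim t)
      then show ?case using True tangent_below[of t x] by (fastforce simp: algebra_simps)
    qed
    ultimately show ?thesis by (rule tendsto_lowerbound) simp
  qed
  then have *: "0 \<le> (1 + f x - \<kappa> * x) * (1 + f x - x * deriv f x)" if "x > 0" for x
    using True that by (intro mult_nonneg_nonneg) auto
  show ?thesis using eventually_gt_at_top[of 0] by (rule eventually_mono) (rule *)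
next
  case False
  then obtain t where t: "t > 0" "1 + f t - t * deriv f t < 0" by force
  show ?thesis using eventually_ge_at_top[of t]
  proof eventually_elim
    case (elim x)
    have "f x + deriv f x * (t - x) \<le> f t" by (rule tangent_below)
    moreover have "t * deriv f t \<le> t * deriv f x" using t elim deriv_mono by (intro mult_left_mono) auto
    moreover have "deriv f x * (t - x) = t * deriv f x - x * deriv f x"
      by (simp add: algebra_simps)
    ultimately have "1 + f x - x * deriv f x < 0" using t(2) by linarith
    moreover have "x * deriv f x \<le> \<kappa> * x" using le[of x] t elim by (simp add: mult.commute)
    ultimately show ?case by (intro mult_nonpos_nonpos) auto
  qed
qed

end

section \<open>Points that run away along a direction\<close>

lemma poly_xy_altdef: "poly_xy P x y = (\<Sum>j\<le>degree P. poly (coeff P j) x * y ^ j)"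
  by (simp add: poly_xy_def poly_altdef[of P] poly_sum)

text \<open>
  The coefficient of $x^A$ in $P(x, t x)$, as a polynomial in $t$: the homogeneous part of $P$
  of total degree $A$, dehomogenised.
\<close>

definition ray_form :: "real poly poly \<Rightarrow> nat \<Rightarrow> real poly"
  where "ray_form P A = (\<Sum>j\<le>degree P. if j \<le> A then monom (coeff (coeff P j) (A - j)) j else 0)"

lemma coeff_ray_form: "coeff (ray_form P A) j = (if j \<le> A then coeff (coeff P j) (A - j) else 0)"
proof (cases "j \<le> degree P")
  case True
  have "coeff (ray_form P A) j = (\<Sum>i\<le>degree P. if i = j then if j \<le> A then coeff (coeff P j) (A - j) else 0 else 0)"
    unfolding ray_form_def coeff_sum by (intro sum.cong) auto
  then show ?thesis using True by simp
next
  case False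
  then have "coeff (ray_form P A) j = 0" unfolding ray_form_def coeff_sum by (intro sum.neutral) auto
  then show ?thesis using False by (simp add: coeff_eq_0)
qed

lemma degree_ray_form_le: "degree (ray_form P A) \<le> degree P"
  by (rule degree_le) (auto simp: coeff_ray_form coeff_eq_0)

lemma poly_xy_on_ray:
  assumes d: "\<And>j. degree (coeff P j) \<le> d"
  shows "poly_xy P x (t * x) = (\<Sum>A\<le>degree P + d. poly (ray_form P A) t * x ^ A)"
proof -
  have "poly (coeff P j) x * (t * x) ^ j =
      (\<Sum>A\<le>degree P + d. (if j \<le> A then coeff (coeff P j) (A - j) * t ^ j else 0) * x ^ A)"
    if "j \<le> degree P" for j
  proof -
    have "poly (coeff P j) x * (t * x) ^ j = (\<Sum>i\<le>degree (coeff P j). coeff (coeff P j) i * t ^ j * x ^ (i + j))"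
      by (simp add: poly_altdef sum_distrib_left sum_distrib_right power_add power_mult_distrib mult_ac)
    also have "\<dots> = (\<Sum>A\<in>(\<lambda>i. i + j) ` {..degree (coeff P j)}. coeff (coeff P j) (A - j) * t ^ j * x ^ A)"
      by (subst sum.reindex) auto
    also have "\<dots> = (\<Sum>A\<le>degree P + d. (if j \<le> A then coeff (coeff P j) (A - j) * t ^ j else 0) * x ^ A)"
    proof (rule sum.mono_neutral_cong_left)
      show "(\<lambda>i. i + j) ` {..degree (coeff P j)} \<subseteq> {..degree P + d}"
        using d[of j] that by auto
      show "\<forall>A\<in>{..degree P + d} - (\<lambda>i. i + j) ` {..degree (coeff P j)}.
          (if j \<le> A then coeff (coeff P j) (A - j) * t ^ j else 0) * x ^ A = 0"
      proof
        fix A assume A: "A \<in> {..degree P + d} - (\<lambda>i. i + j) ` {..degree (coeff P j)}"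
        show "(if j \<le> A then coeff (coeff P j) (A - j) * t ^ j else 0) * x ^ A = 0"
        proof (cases "j \<le> A")
          case True
          then have "A = (A - j) + j" by simp
          then have "\<not> A - j \<le> degree (coeff P j)" using A by (metis DiffD2 atMost_iff image_eqI)
          then show ?thesis by (simp add: coeff_eq_0)
        qed simp
      qed
    qed auto
    finally show ?thesis .
  qed
  then have "poly_xy P x (t * x) = (\<Sum>j\<le>degree P. \<Sum>A\<le>degree P + d.
      (if j \<le> A then coeff (coeff P j) (A - j) * t ^ j else 0) * x ^ A)"
    unfolding poly_xy_altdef by (intro sum.cong) auto
  also have "\<dots> = (\<Sum>A\<le>degree P + d. \<Sum>j\<le>degree P.
      (if j \<le> A then coeff (coeff P j) (A - j) * t ^ j else 0) * x ^ A)"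
    by (rule sum.swap)
  also have "\<dots> = (\<Sum>A\<le>degree P + d. poly (ray_form P A) t * x ^ A)"
    unfolding ray_form_def poly_sum sum_distrib_right by (intro sum.cong) (auto simp: poly_monom)
  finally show ?thesis .
qed

lemma ray_form_nonzero:
  assumes "P \<noteq> 0"
  shows "\<exists>A. ray_form P A \<noteq> 0"
proof -
  have "coeff (coeff P (degree P)) (degree (lead_coeff P)) \<noteq> 0" using assms by simp
  then have "coeff (ray_form P (degree P + degree (lead_coeff P))) (degree P) \<noteq> 0"
    by (simp add: coeff_ray_form)
  then show ?thesis by (metis coeff_0)
qed

text \<open>
  If a point runs to infinity with limiting slope $\kappa$, the leading form of $P$ at its slope
  has size at least $|t - \kappa|^e$ up to a constant, where $e \le n$ is the order of vanishing
  at $\kappa$. When $|t - \kappa|$ is not below $\delta / |R|$, this beats the lower forms,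
  which are smaller than the leading term by a factor $O(1 / x)$.
\<close>

lemma poly_eventually_nonzero_near_direction:
  fixes x t R :: "real \<Rightarrow> real"
  assumes P: "P \<noteq> 0" "degree P \<le> n"
    and x: "filterlim x at_infinity F" and t: "(t \<longlongrightarrow> \<kappa>) F"
    and R: "filterlim R at_infinity F" and small: "((\<lambda>s. R s ^ n / x s) \<longlongrightarrow> 0) F"
    and \<delta>: "\<delta> > 0" and away: "\<forall>\<^sub>F s in F. \<delta> \<le> \<bar>t s - \<kappa>\<bar> * \<bar>R s\<bar>"
  shows "\<forall>\<^sub>F s in F. poly_xy P (x s) (t s * x s) \<noteq> 0"
proof -
  define d where "d = Max ((\<lambda>j. degree (coeff P j)) ` {..degree P})"
  have d: "degree (coeff P j) \<le> d" for j
  proof (cases "j \<le> degree P")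
    case True then show ?thesis unfolding d_def by (intro Max_ge) auto
  qed (simp add: coeff_eq_0)
  define N where "N = degree P + d"
  have ray_form_0: "ray_form P A = 0" if "A > N" for A
  proof (rule poly_eqI)
    fix j show "coeff (ray_form P A) j = coeff 0 j"
    proof (cases "j \<le> degree P")
      case True
      then have "A - j > degree (coeff P j)" using that d[of j] by (simp add: N_def)
      then show ?thesis by (simp add: coeff_ray_form coeff_eq_0)
    qed (simp add: coeff_ray_form coeff_eq_0)
  qed
  define A where "A = (GREATEST A. ray_form P A \<noteq> 0)"
  have bounded: "B \<le> N" if "ray_form P B \<noteq> 0" for B using ray_form_0[of B] that by force
  obtain B where "ray_form P B \<noteq> 0" using ray_form_nonzero[OF P(1)] by blast
  then have A: "ray_form P A \<noteq> 0" unfolding A_def by (rule GreatestI_nat) (rule bounded)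
  have A_max: "ray_form P B = 0" if "B > A" for B
  proof (rule ccontr)
    assume "ray_form P B \<noteq> 0"
    then have "B \<le> A" unfolding A_def by (rule Greatest_le_nat) (rule bounded)
    with that show False by simp
  qed
  define e where "e = order \<kappa> (ray_form P A)"
  obtain h where h: "ray_form P A = [:- \<kappa>, 1:] ^ e * h" "\<not> [:- \<kappa>, 1:] dvd h"
    using order_decomp[OF A, of \<kappa>] unfolding e_def by blast
  have h_ne: "poly h \<kappa> \<noteq> 0" using h(2) by (simp add: poly_eq_0_iff_dvd)
  have e: "e \<le> n" using order_degree[OF A, of \<kappa>] degree_ray_form_le[of P A] P(2) by (simp add: e_def)
  \<comment> \<open>The lower forms, scaled so that they stay bounded next to x times the leading form.\<close>
  define E where "E s = (\<Sum>B<A. poly (ray_form P B) (t s) * (1 / x s) ^ (A - B - 1))" for s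
  have "((\<lambda>s. 1 / x s) \<longlongrightarrow> 0) F" using tendsto_divide_0[OF tendsto_const x] .
  then have "(E \<longlongrightarrow> (\<Sum>B<A. poly (ray_form P B) \<kappa> * 0 ^ (A - B - 1))) F"
    unfolding E_def by (intro tendsto_intros t)
  from tendsto_mult[OF this small] have "((\<lambda>s. E s * (R s ^ n / x s)) \<longlongrightarrow> 0) F" by simp
  moreover have "\<delta> ^ e * (\<bar>poly h \<kappa>\<bar> / 2) > 0" using \<delta> h_ne by simp
  ultimately have ev1: "\<forall>\<^sub>F s in F. \<bar>E s * (R s ^ n / x s)\<bar> < \<delta> ^ e * (\<bar>poly h \<kappa>\<bar> / 2)"
    by (intro order_tendstoD(2)[OF tendsto_rabs_zero])
  have "((\<lambda>s. \<bar>poly h (t s)\<bar>) \<longlongrightarrow> \<bar>poly h \<kappa>\<bar>) F" by (intro tendsto_intros t)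
  then have ev2: "\<forall>\<^sub>F s in F. \<bar>poly h \<kappa>\<bar> / 2 < \<bar>poly h (t s)\<bar>"
    by (rule order_tendstoD(1)) (use h_ne in simp)
  have ev3: "\<forall>\<^sub>F s in F. 1 \<le> \<bar>R s\<bar>"
    using R unfolding filterlim_at_infinity[OF order_refl] real_norm_def by (auto dest: spec[of _ 1])
  show ?thesis
    using ev1 ev2 ev3 away filterlim_at_infinity_imp_eventually_ne[OF x, of 0]
  proof eventually_elim
    case (elim s)
    show ?case
    proof
      assume "poly_xy P (x s) (t s * x s) = 0"
      then have "0 = (\<Sum>B\<le>N. poly (ray_form P B) (t s) * x s ^ B)"
        using poly_xy_on_ray[OF d] by (simp add: N_def)
      also have "\<dots> = (\<Sum>B\<le>A. poly (ray_form P B) (t s) * x s ^ B)"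
        using ray_form_0 A_max A
        by (intro sum.mono_neutral_right) (auto simp: not_le intro: bounded)
      also have "\<dots> = poly (ray_form P A) (t s) * x s ^ A + (\<Sum>B<A. poly (ray_form P B) (t s) * x s ^ B)"
        by (simp add: sum.lessThan_Suc flip: lessThan_Suc_atMost)
      also have "(\<Sum>B<A. poly (ray_form P B) (t s) * x s ^ B) = E s * (x s ^ A / x s)"
        unfolding E_def sum_distrib_right
      proof (intro sum.cong refl)
        fix B assume "B \<in> {..<A}"
        then have "A = Suc (A - B - 1) + B" by simp
        then have "x s ^ A = x s * x s ^ (A - B - 1) * x s ^ B" by (metis power_Suc power_add)
        then show "poly (ray_form P B) (t s) * x s ^ B
            = poly (ray_form P B) (t s) * (1 / x s) ^ (A - B - 1) * (x s ^ A / x s)"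
          using elim by (simp add: power_divide)
      qed
      also have "poly (ray_form P A) (t s) * x s ^ A + E s * (x s ^ A / x s)
          = (poly (ray_form P A) (t s) + E s / x s) * x s ^ A" using elim by (simp add: field_simps)
      finally have "poly (ray_form P A) (t s) = - (E s / x s)" using elim by simp
      then have "\<bar>(t s - \<kappa>) ^ e * poly h (t s) * R s ^ n\<bar> = \<bar>E s * (R s ^ n / x s)\<bar>"
        unfolding h(1) by (simp add: abs_mult)
      moreover have "\<delta> ^ e * (\<bar>poly h \<kappa>\<bar> / 2) \<le> \<bar>(t s - \<kappa>) ^ e * poly h (t s) * R s ^ n\<bar>"
      proof -
        have "\<delta> ^ e \<le> (\<bar>t s - \<kappa>\<bar> * \<bar>R s\<bar>) ^ e" using elim \<delta> by (intro power_mono) auto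
        also have "\<dots> = \<bar>t s - \<kappa>\<bar> ^ e * \<bar>R s\<bar> ^ e" by (rule power_mult_distrib)
        also have "\<dots> \<le> \<bar>t s - \<kappa>\<bar> ^ e * \<bar>R s\<bar> ^ n"
          using e elim by (intro mult_left_mono power_increasing) auto
        finally have "\<delta> ^ e * (\<bar>poly h \<kappa>\<bar> / 2) \<le> (\<bar>t s - \<kappa>\<bar> ^ e * \<bar>R s\<bar> ^ n) * \<bar>poly h (t s)\<bar>"
          using elim by (intro mult_mono) auto
        then show ?thesis by (simp add: abs_mult power_abs mult_ac)
      qed
      ultimately show False using elim by simp
    qed
  qed
qed

section \<open>Orbits that start far out\<close>

text \<open>
  Orbits of \<open>advance\<close> that start far out in the direction of an asymptote of slope
  $\kappa$, with a tangent that has almost the same slope. The index of $X$, $Y$, $P$ counts the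
  steps; the filter says how the starting point runs to infinity.
\<close>

locale escaping_orbit =
  fixes F :: "real filter" and X Y P :: "nat \<Rightarrow> real \<Rightarrow> real" and \<kappa> :: real
  assumes slope_pos: "\<kappa> > 0"
    and orbit: "(X (Suc k) t, Y (Suc k) t, P (Suc k) t) = advance (X k t, Y k t, P k t)"
    and X0: "filterlim (X 0) at_infinity F"
    and Y0: "((\<lambda>t. Y 0 t / X 0 t) \<longlongrightarrow> \<kappa>) F"
    and P0: "(P 0 \<longlongrightarrow> \<kappa>) F"
    and D0: "\<forall>\<^sub>F t in F. 1 + Y 0 t - X 0 t * P 0 t \<noteq> 0"
begin

text \<open>
  The denominator in step $k$; it measures where the tangent line meets the axis relative to
  $(0, -1)$.
\<close>

definition D :: "nat \<Rightarrow> real \<Rightarrow> real"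
  where "D k t = 1 + Y k t - X k t * P k t"

definition R :: "real \<Rightarrow> real"
  where "R t = X 1 t / X 0 t"

text \<open>
  A normal replaces slope $\kappa$ by $-1/\kappa$, and the reflection between the two curves
  restores the sign.
\<close>

definition slope :: "nat \<Rightarrow> real"
  where "slope k = (if even k then \<kappa> else 1 / \<kappa>)"

text \<open>
  The limit of $X_{k+1} / (X_k R)$. What matters is that it does not vanish and that its sign
  alternates.
\<close>

primrec \<rho> :: "nat \<Rightarrow> real"
  where "\<rho> 0 = 1" | "\<rho> (Suc k) = - (slope (Suc k))\<^sup>2 * \<rho> k"

text \<open>
  The limit of $- D_{k+1} / X_k$; it does not depend on $k$ because inverting the slope leaves
  it unchanged.
\<close>

definition \<eta> :: real
  where "\<eta> = (\<kappa> + 1 / \<kappa>) / 2"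

lemma slope_positive: "slope k > 0"
  using slope_pos by (simp add: slope_def)

lemma slope_Suc: "slope (Suc k) = 1 / slope k"
  by (simp add: slope_def)

lemma eta_pos: "\<eta> > 0"
  using slope_pos by (simp add: \<eta>_def add_pos_pos)

lemma eta_slope: "\<eta> = (slope k + 1 / slope k) / 2"
  by (simp add: \<eta>_def slope_def)

lemma rho_sign: "(-1) ^ k * \<rho> k > 0"
proof (induction k)
  case (Suc k)
  have "(-1) ^ Suc k * \<rho> (Suc k) = (slope (Suc k))\<^sup>2 * ((-1) ^ k * \<rho> k)" by simp
  also have "\<dots> > 0" using Suc slope_positive[of "Suc k"] by (simp only: mult_pos_pos zero_less_power)
  finally show ?case .
qed simp

lemma rho_nonzero: "\<rho> k \<noteq> 0"
  using rho_sign[of k] by auto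

lemma X_Suc: "X (Suc k) t = X k t + ((X k t)\<^sup>2 + (1 + Y k t)\<^sup>2) / (2 * D k t) * P k t"
  and Y_Suc: "Y (Suc k) t = ((X k t)\<^sup>2 + (1 + Y k t)\<^sup>2) / (2 * D k t) - Y k t"
  and P_Suc: "P (Suc k) t = X k t / (1 + Y k t)"
  using orbit[of k t] by (simp_all add: Let_def D_def)

lemma X_ratio:
  assumes "X k t \<noteq> 0" "D k t \<noteq> 0"
  shows "X (Suc k) t / X k t = 1 + P k t * (1 + (1 / X k t + Y k t / X k t)\<^sup>2) / 2 / (D k t / X k t)"
proof -
  define N where "N = (X k t)\<^sup>2 + (1 + Y k t)\<^sup>2"
  have "1 / X k t + Y k t / X k t = (1 + Y k t) / X k t" by (simp add: add_divide_distrib)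
  moreover have "1 + (u / x)\<^sup>2 = (x\<^sup>2 + u\<^sup>2) / x\<^sup>2" if "x \<noteq> 0" for x u :: real
    using that by (simp add: power_divide add_divide_distrib)
  then have "1 + ((1 + Y k t) / X k t)\<^sup>2 = N / (X k t)\<^sup>2"
    unfolding N_def using assms(1) by blast
  moreover have "X (Suc k) t / X k t = 1 + N / (2 * D k t) * P k t / X k t"
    using assms(1) by (simp add: X_Suc N_def add_divide_distrib)
  ultimately show ?thesis using assms by (simp add: power2_eq_square mult_ac)
qed

lemma Y_ratio:
  assumes "X k t \<noteq> 0" "X (Suc k) t \<noteq> 0" "P k t \<noteq> 0"
  shows "Y (Suc k) t / X (Suc k) t =
    (1 - X k t / X (Suc k) t) / P k t - Y k t / X k t * (X k t / X (Suc k) t)"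
proof -
  have "Y (Suc k) t = (X (Suc k) t - X k t) / P k t - Y k t"
    using assms by (simp add: X_Suc Y_Suc)
  moreover have "(x' - x) / p / x' = (1 - x / x') / p" if "x' \<noteq> 0" for x x' p :: real
    using that by (simp add: field_simps)
  ultimately show ?thesis using assms by (simp add: diff_divide_distrib)
qed

text \<open>
  The new tangent is the bisector of $(0, 1)$ and the old point, so that its intercept with the
  axis depends on the old point alone: all traces of the old slope cancel. This is what makes
  the denominators $D_{k+1}$ comparable to $X_k$ whatever the previous step was.
\<close>

lemma D_Suc:
  assumes "D k t \<noteq> 0" "1 + Y k t \<noteq> 0"
  shows "D (Suc k) t = ((3 - Y k t) * (1 + Y k t) - (X k t)\<^sup>2) / (2 * (1 + Y k t))"
proof -
  define S where "S = ((X k t)\<^sup>2 + (1 + Y k t)\<^sup>2) / (2 * D k t)"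
  have S: "2 * D k t * S = (X k t)\<^sup>2 + (1 + Y k t)\<^sup>2" using assms by (simp add: S_def)
  have "D (Suc k) t = 1 + (S - Y k t) - (X k t + S * P k t) * (X k t / (1 + Y k t))"
    by (simp add: D_def[of "Suc k"] X_Suc Y_Suc P_Suc S_def)
  then have "2 * (1 + Y k t) * D (Suc k) t
      = 2 * ((1 + S - Y k t) * (1 + Y k t) - (X k t + S * P k t) * X k t)"
    using assms by (simp add: field_simps)
  also have "\<dots> = 2 * ((1 - Y k t) * (1 + Y k t) - (X k t)\<^sup>2) + 2 * D k t * S"
    by (simp add: D_def power2_eq_square algebra_simps)
  also have "\<dots> = (3 - Y k t) * (1 + Y k t) - (X k t)\<^sup>2"
    unfolding S by (simp add: power2_eq_square algebra_simps)
  finally show ?thesis using assms by (simp add: field_simps)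
qed

lemma tendsto_inverse_X:
  assumes "filterlim (X k) at_infinity F"
  shows "((\<lambda>t. 1 / X k t) \<longlongrightarrow> 0) F"
  using tendsto_divide_0[OF tendsto_const assms] .

lemma D0_ratio: "((\<lambda>t. D 0 t / X 0 t) \<longlongrightarrow> 0) F"
proof -
  have "((\<lambda>t. 1 / X 0 t + Y 0 t / X 0 t - P 0 t) \<longlongrightarrow> 0 + \<kappa> - \<kappa>) F"
    by (intro tendsto_intros tendsto_inverse_X X0 Y0 P0)
  moreover have "\<forall>\<^sub>F t in F. 1 / X 0 t + Y 0 t / X 0 t - P 0 t = D 0 t / X 0 t"
    using filterlim_at_infinity_imp_eventually_ne[OF X0, of 0]
    by eventually_elim (simp add: D_def field_simps)
  ultimately show ?thesis using Lim_transform_eventually by force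
qed

text \<open>
  In the first step the tangent is almost parallel to the line from $(0, -1)$ to the point, so
  the denominator $D_0$ is small in comparison with $X_0$.
\<close>

lemma R_at_infinity: "filterlim R at_infinity F"
proof -
  have "((\<lambda>t. P 0 t * (1 + (1 / X 0 t + Y 0 t / X 0 t)\<^sup>2) / 2) \<longlongrightarrow> \<kappa> * (1 + (0 + \<kappa>)\<^sup>2) / 2) F"
    by (intro tendsto_intros tendsto_inverse_X X0 Y0 P0) simp
  moreover have "filterlim (\<lambda>t. D 0 t / X 0 t) (at 0) F"
    unfolding filterlim_at
    using D0_ratio filterlim_at_infinity_imp_eventually_ne[OF X0, of 0] D0
    by (auto simp: D_def elim: eventually_elim2)
  moreover have "\<kappa> * (1 + (0 + \<kappa>)\<^sup>2) / 2 \<noteq> 0"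
    using slope_pos by (simp add: add_nonneg_eq_0_iff)
  ultimately have "filterlim (\<lambda>t. P 0 t * (1 + (1 / X 0 t + Y 0 t / X 0 t)\<^sup>2) / 2 / (D 0 t / X 0 t))
      at_infinity F"
    by (intro filterlim_divide_at_infinity)
  then have "filterlim (\<lambda>t. 1 + P 0 t * (1 + (1 / X 0 t + Y 0 t / X 0 t)\<^sup>2) / 2 / (D 0 t / X 0 t))
      at_infinity F"
    by (rule tendsto_add_filterlim_at_infinity[OF tendsto_const])
  moreover have "\<forall>\<^sub>F t in F. R t = 1 + P 0 t * (1 + (1 / X 0 t + Y 0 t / X 0 t)\<^sup>2) / 2 / (D 0 t / X 0 t)"
    using filterlim_at_infinity_imp_eventually_ne[OF X0, of 0] D0
    by eventually_elim (use X_ratio[of 0] in \<open>simp add: R_def D_def\<close>)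
  ultimately show ?thesis using filterlim_cong by force
qed

lemma one_plus_Y_ratio:
  assumes "filterlim (X k) at_infinity F" "((\<lambda>t. Y k t / X k t) \<longlongrightarrow> slope k) F"
  shows "((\<lambda>t. (1 + Y k t) / X k t) \<longlongrightarrow> slope k) F" "\<forall>\<^sub>F t in F. 1 + Y k t \<noteq> 0"
proof -
  have "((\<lambda>t. 1 / X k t + Y k t / X k t) \<longlongrightarrow> 0 + slope k) F"
    by (intro tendsto_add tendsto_inverse_X assms)
  then show *: "((\<lambda>t. (1 + Y k t) / X k t) \<longlongrightarrow> slope k) F"
    by (simp add: add_divide_distrib)
  have "\<forall>\<^sub>F t in F. (1 + Y k t) / X k t \<noteq> 0"
    by (rule tendsto_imp_eventually_ne[OF *]) (use slope_positive[of k] in simp)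
  then show "\<forall>\<^sub>F t in F. 1 + Y k t \<noteq> 0" by eventually_elim auto
qed

text \<open>
  One step multiplies the abscissa by a factor of order $R$, while the next denominator is only
  of the order of the old abscissa. Hence $D_{k+1} / X_{k+1}$ is of order $1 / R$ and the next
  step gains another factor $R$.
\<close>

lemma orbit_step:
  assumes X: "filterlim (X k) at_infinity F" and Y: "((\<lambda>t. Y k t / X k t) \<longlongrightarrow> slope k) F"
    and Dk: "\<forall>\<^sub>F t in F. D k t \<noteq> 0"
    and Xr: "((\<lambda>t. X (Suc k) t / (X k t * R t)) \<longlongrightarrow> \<rho> k) F"
  shows "filterlim (X (Suc k)) at_infinity F"
    and "\<forall>\<^sub>F t in F. D (Suc k) t \<noteq> 0"
    and "((\<lambda>t. X k t / X (Suc k) t) \<longlongrightarrow> 0) F"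
    and "((\<lambda>t. X k t * R t / X (Suc k) t) \<longlongrightarrow> 1 / \<rho> k) F"
    and "((\<lambda>t. D (Suc k) t * R t / X (Suc k) t) \<longlongrightarrow> - \<eta> / \<rho> k) F"
proof -
  have ne: "\<forall>\<^sub>F t in F. X k t \<noteq> 0" "\<forall>\<^sub>F t in F. R t \<noteq> 0"
    using X R_at_infinity filterlim_at_infinity_imp_eventually_ne by auto
  note Y1 = one_plus_Y_ratio[OF X Y]
  have "filterlim (\<lambda>t. X (Suc k) t / (X k t * R t) * X k t) at_infinity F"
    by (rule tendsto_mult_filterlim_at_infinity[OF Xr rho_nonzero X])
  then have "filterlim (\<lambda>t. R t * (X (Suc k) t / (X k t * R t) * X k t)) at_infinity F"
    by (rule filterlim_at_infinity_times[OF R_at_infinity])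
  moreover have "\<forall>\<^sub>F t in F. R t * (X (Suc k) t / (X k t * R t) * X k t) = X (Suc k) t"
    using ne by eventually_elim simp
  ultimately show "filterlim (X (Suc k)) at_infinity F"
    by (simp cong: filterlim_cong)
  show inv: "((\<lambda>t. X k t * R t / X (Suc k) t) \<longlongrightarrow> 1 / \<rho> k) F"
    using tendsto_inverse[OF Xr rho_nonzero] by (simp add: inverse_eq_divide)
  have "((\<lambda>t. X k t * R t / X (Suc k) t / R t) \<longlongrightarrow> 0) F"
    by (rule tendsto_divide_0[OF inv R_at_infinity])
  moreover have "\<forall>\<^sub>F t in F. X k t * R t / X (Suc k) t / R t = X k t / X (Suc k) t"
    using ne by eventually_elim simp
  ultimately show "((\<lambda>t. X k t / X (Suc k) t) \<longlongrightarrow> 0) F"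
    by (rule Lim_transform_eventually)
  have "((\<lambda>t. (3 * (1 / X k t) - Y k t / X k t) / 2 - 1 / (2 * ((1 + Y k t) / X k t)))
      \<longlongrightarrow> (3 * 0 - slope k) / 2 - 1 / (2 * slope k)) F"
    using slope_positive[of k] by (intro tendsto_intros tendsto_inverse_X X Y Y1) auto
  moreover have "(3 * 0 - slope k) / 2 - 1 / (2 * slope k) = - \<eta>"
    using slope_positive[of k] by (simp add: eta_slope[of k] field_simps)
  ultimately have "((\<lambda>t. (3 * (1 / X k t) - Y k t / X k t) / 2 - 1 / (2 * ((1 + Y k t) / X k t)))
      \<longlongrightarrow> - \<eta>) F"
    by metis
  moreover have "\<forall>\<^sub>F t in F.
      (3 * (1 / X k t) - Y k t / X k t) / 2 - 1 / (2 * ((1 + Y k t) / X k t)) = D (Suc k) t / X k t"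
    using ne(1) Y1(2) Dk
  proof eventually_elim
    case (elim t)
    have "(3 * (1 / x) - y / x) / 2 - 1 / (2 * ((1 + y) / x))
        = ((3 - y) * (1 + y) - x\<^sup>2) / (2 * (1 + y)) / x" if "x \<noteq> 0" "1 + y \<noteq> 0" for x y :: real
    proof -
      have "((3 - y) * (1 + y) - x\<^sup>2) / (2 * (1 + y)) = (3 - y) / 2 - x\<^sup>2 / (2 * (1 + y))"
        unfolding diff_divide_distrib[of _ "x\<^sup>2"]
        by (simp only: nonzero_mult_divide_mult_cancel_right[OF that(2)])
      then have "((3 - y) * (1 + y) - x\<^sup>2) / (2 * (1 + y)) / x = (3 - y) / 2 / x - x / (2 * (1 + y))"
        using that(1) by (simp add: diff_divide_distrib[of "(3 - y) / 2"] power2_eq_square)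
      then show ?thesis by (simp add: diff_divide_distrib)
    qed
    then show ?case using elim by (simp add: D_Suc)
  qed
  ultimately have DX: "((\<lambda>t. D (Suc k) t / X k t) \<longlongrightarrow> - \<eta>) F"
    by (rule Lim_transform_eventually)
  have "\<forall>\<^sub>F t in F. D (Suc k) t / X k t \<noteq> 0"
    by (rule tendsto_imp_eventually_ne[OF DX]) (use eta_pos in simp)
  then show "\<forall>\<^sub>F t in F. D (Suc k) t \<noteq> 0" by eventually_elim auto
  have "((\<lambda>t. D (Suc k) t / X k t * (X k t * R t / X (Suc k) t)) \<longlongrightarrow> - \<eta> * (1 / \<rho> k)) F"
    by (intro tendsto_mult DX inv)
  moreover have "\<forall>\<^sub>F t in F. D (Suc k) t / X k t * (X k t * R t / X (Suc k) t)
      = D (Suc k) t * R t / X (Suc k) t"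
    using ne by eventually_elim simp
  ultimately have "((\<lambda>t. D (Suc k) t * R t / X (Suc k) t) \<longlongrightarrow> - \<eta> * (1 / \<rho> k)) F"
    by (rule Lim_transform_eventually)
  then show "((\<lambda>t. D (Suc k) t * R t / X (Suc k) t) \<longlongrightarrow> - \<eta> / \<rho> k) F" by simp
qed

text \<open>
  Proved by one induction, because the growth in each step needs the directions in the previous
  one and conversely.
\<close>

lemma orbit_asymptotics:
  "filterlim (X k) at_infinity F \<and>
   ((\<lambda>t. Y k t / X k t) \<longlongrightarrow> slope k) F \<and>
   (P k \<longlongrightarrow> slope k) F \<and>
   (\<forall>\<^sub>F t in F. D k t \<noteq> 0) \<and>
   ((\<lambda>t. X (Suc k) t / (X k t * R t)) \<longlongrightarrow> \<rho> k) F"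
proof (induction k)
  case 0
  have "\<forall>\<^sub>F t in F. 1 = X (Suc 0) t / (X 0 t * R t)"
    using filterlim_at_infinity_imp_eventually_ne[OF X0, of 0]
      filterlim_at_infinity_imp_eventually_ne[OF R_at_infinity, of 0]
    by eventually_elim (simp add: R_def)
  then have "((\<lambda>t. X (Suc 0) t / (X 0 t * R t)) \<longlongrightarrow> 1) F"
    by (rule Lim_transform_eventually[OF tendsto_const])
  then show ?case using X0 Y0 P0 D0 by (simp add: slope_def D_def)
next
  case (Suc k)
  then have X: "filterlim (X k) at_infinity F" and Y: "((\<lambda>t. Y k t / X k t) \<longlongrightarrow> slope k) F"
    and P: "(P k \<longlongrightarrow> slope k) F" and Dk: "\<forall>\<^sub>F t in F. D k t \<noteq> 0"
    and Xr: "((\<lambda>t. X (Suc k) t / (X k t * R t)) \<longlongrightarrow> \<rho> k) F" by blast+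
  note XS = orbit_step(1)[OF X Y Dk Xr] and DS = orbit_step(2)[OF X Y Dk Xr]
    and XX = orbit_step(3)[OF X Y Dk Xr] and DR = orbit_step(5)[OF X Y Dk Xr]
  have ne: "\<forall>\<^sub>F t in F. X k t \<noteq> 0" "\<forall>\<^sub>F t in F. X (Suc k) t \<noteq> 0" "\<forall>\<^sub>F t in F. R t \<noteq> 0"
    using X XS R_at_infinity filterlim_at_infinity_imp_eventually_ne by auto
  have Pne: "\<forall>\<^sub>F t in F. P k t \<noteq> 0"
    by (rule tendsto_imp_eventually_ne[OF P]) (use slope_positive[of k] in simp)
  have "((\<lambda>t. (1 - X k t / X (Suc k) t) / P k t - Y k t / X k t * (X k t / X (Suc k) t))
      \<longlongrightarrow> (1 - 0) / slope k - slope k * 0) F"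
    using slope_positive[of k] by (intro tendsto_intros Y P XX) auto
  then have "((\<lambda>t. (1 - X k t / X (Suc k) t) / P k t - Y k t / X k t * (X k t / X (Suc k) t))
      \<longlongrightarrow> slope (Suc k)) F"
    by (simp add: slope_Suc)
  moreover have "\<forall>\<^sub>F t in F. (1 - X k t / X (Suc k) t) / P k t - Y k t / X k t * (X k t / X (Suc k) t)
      = Y (Suc k) t / X (Suc k) t"
    using ne(1,2) Pne by eventually_elim (rule Y_ratio[symmetric])
  ultimately have YS: "((\<lambda>t. Y (Suc k) t / X (Suc k) t) \<longlongrightarrow> slope (Suc k)) F"
    by (rule Lim_transform_eventually)
  have "((\<lambda>t. inverse ((1 + Y k t) / X k t)) \<longlongrightarrow> inverse (slope k)) F"
    using slope_positive[of k] by (intro tendsto_inverse one_plus_Y_ratio X Y) auto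
  then have PS: "(P (Suc k) \<longlongrightarrow> slope (Suc k)) F"
    by (simp add: P_Suc[abs_def] slope_Suc inverse_eq_divide)
  let ?r = "\<lambda>t. 1 / R t + P (Suc k) t * (1 + (1 / X (Suc k) t + Y (Suc k) t / X (Suc k) t)\<^sup>2) / 2
        / (D (Suc k) t * R t / X (Suc k) t)"
  have "(?r \<longlongrightarrow> 0 + slope (Suc k) * (1 + (0 + slope (Suc k))\<^sup>2) / 2 / (- \<eta> / \<rho> k)) F"
    using eta_pos rho_nonzero[of k]
    by (intro tendsto_intros tendsto_inverse_X tendsto_divide_0[OF _ R_at_infinity] XS YS PS DR) auto
  moreover have "0 + slope (Suc k) * (1 + (0 + slope (Suc k))\<^sup>2) / 2 / (- \<eta> / \<rho> k) = \<rho> (Suc k)"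
  proof -
    have "slope (Suc k) * (1 + (slope (Suc k))\<^sup>2) / 2 = \<eta> * (slope (Suc k))\<^sup>2"
      using slope_positive[of "Suc k"] by (simp add: eta_slope[of "Suc k"] power2_eq_square field_simps)
    then show ?thesis using eta_pos by simp
  qed
  ultimately have "(?r \<longlongrightarrow> \<rho> (Suc k)) F" by metis
  moreover have "\<forall>\<^sub>F t in F. ?r t = X (Suc (Suc k)) t / (X (Suc k) t * R t)"
    using ne(2,3) DS
  proof eventually_elim
    case (elim t)
    have "X (Suc (Suc k)) t / (X (Suc k) t * R t) = (X (Suc (Suc k)) t / X (Suc k) t) / R t" by simp
    also have "\<dots> = (1 + P (Suc k) t * (1 + (1 / X (Suc k) t + Y (Suc k) t / X (Suc k) t)\<^sup>2) / 2
        / (D (Suc k) t / X (Suc k) t)) / R t"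
      using elim by (subst X_ratio) auto
    also have "\<dots> = ?r t" by (simp add: add_divide_distrib mult.commute)
    finally show ?case by simp
  qed
  ultimately have "((\<lambda>t. X (Suc (Suc k)) t / (X (Suc k) t * R t)) \<longlongrightarrow> \<rho> (Suc k)) F"
    by (rule Lim_transform_eventually)
  then show ?case using XS YS PS DS by blast
qed

text \<open>
  The deviation of the point from the line of slope \<open>slope k\<close> through $(0, -1)$,
  divided by the abscissa and magnified by $R$. Working with the line through $(0, -1)$ rather
  than through the origin makes the recursion exact.
\<close>

definition V :: "nat \<Rightarrow> real \<Rightarrow> real"
  where "V k t = (1 + Y k t - slope k * X k t) * R t / X k t"

lemma V_Suc:
  assumes "1 + Y k t \<noteq> 0" "X k t \<noteq> 0" "X (Suc k) t \<noteq> 0"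
  shows "V (Suc k) t = D (Suc k) t * R t / X (Suc k) t - V k t / (slope k * ((1 + Y k t) / X k t))"
proof -
  define u where "u = slope k * X k t - (1 + Y k t)"
  have "P (Suc k) t - slope (Suc k) = u / (slope k * (1 + Y k t))"
    using assms slope_positive[of k] by (simp add: P_Suc slope_Suc u_def field_simps)
  moreover have "1 + Y (Suc k) t - slope (Suc k) * X (Suc k) t =
      D (Suc k) t + X (Suc k) t * (P (Suc k) t - slope (Suc k))"
    by (simp add: D_def algebra_simps)
  ultimately have "1 + Y (Suc k) t - slope (Suc k) * X (Suc k) t =
      D (Suc k) t + X (Suc k) t * (u / (slope k * (1 + Y k t)))"
    by simp
  then have "V (Suc k) t = D (Suc k) t * R t / X (Suc k) t + u / (slope k * (1 + Y k t)) * R t"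
    using assms by (simp add: V_def add_divide_distrib distrib_right)
  moreover have "V k t = - (u * R t / X k t)"
    by (simp add: V_def u_def minus_divide_left left_diff_distrib)
  ultimately show ?thesis using assms by simp
qed

text \<open>
  Both terms of the recursion for $V$ have the sign $(-1)^{k+1}$ eventually, so they cannot
  cancel, and the first one tends to a nonzero limit.
\<close>

lemma V_alternates:
  assumes "\<forall>\<^sub>F t in F. 0 \<le> (-1) ^ k * V k t"
  shows "\<exists>\<delta>>0. \<forall>\<^sub>F t in F. \<delta> \<le> (-1) ^ Suc k * V (Suc k) t"
proof -
  note A = orbit_asymptotics[of k]
  have X: "filterlim (X k) at_infinity F" and Y: "((\<lambda>t. Y k t / X k t) \<longlongrightarrow> slope k) F"
    using A by auto
  have ne: "\<forall>\<^sub>F t in F. X k t \<noteq> 0" "\<forall>\<^sub>F t in F. X (Suc k) t \<noteq> 0"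
    using A orbit_asymptotics[of "Suc k"] filterlim_at_infinity_imp_eventually_ne by auto
  note Y1 = one_plus_Y_ratio[OF X Y]
  have pos: "\<forall>\<^sub>F t in F. 0 < (1 + Y k t) / X k t"
    by (rule order_tendstoD(1)[OF Y1(1) slope_positive])
  define \<delta> where "\<delta> = (-1) ^ k * \<eta> / \<rho> k / 2"
  have "\<delta> > 0"
  proof -
    have "\<delta> = \<eta> / ((-1) ^ k * \<rho> k) / 2" by (simp add: \<delta>_def minus_one_power_iff)
    then show ?thesis using eta_pos rho_sign[of k] by (simp only: divide_pos_pos zero_less_numeral)
  qed
  have "((\<lambda>t. (-1) ^ Suc k * (D (Suc k) t * R t / X (Suc k) t)) \<longlongrightarrow> (-1) ^ Suc k * (- \<eta> / \<rho> k)) F"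
    using A by (intro tendsto_mult tendsto_const orbit_step(5)) auto
  moreover have "(-1) ^ Suc k * (- \<eta> / \<rho> k) = 2 * \<delta>" by (simp add: \<delta>_def)
  ultimately have "((\<lambda>t. (-1) ^ Suc k * (D (Suc k) t * R t / X (Suc k) t)) \<longlongrightarrow> 2 * \<delta>) F" by simp
  then have "\<forall>\<^sub>F t in F. \<delta> < (-1) ^ Suc k * (D (Suc k) t * R t / X (Suc k) t)"
    by (rule order_tendstoD(1)) (use \<open>\<delta> > 0\<close> in simp)
  then have "\<forall>\<^sub>F t in F. \<delta> \<le> (-1) ^ Suc k * V (Suc k) t"
    using ne Y1(2) pos assms
  proof eventually_elim
    case (elim t)
    have "(-1) ^ Suc k * V (Suc k) t = (-1) ^ Suc k * (D (Suc k) t * R t / X (Suc k) t)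
        + (-1) ^ k * V k t / (slope k * ((1 + Y k t) / X k t))"
      using elim by (simp add: V_Suc algebra_simps)
    moreover have "0 \<le> (-1) ^ k * V k t / (slope k * ((1 + Y k t) / X k t))"
      using elim slope_positive[of k] by (intro divide_nonneg_pos mult_pos_pos) auto
    ultimately show ?case using elim by linarith
  qed
  with \<open>\<delta> > 0\<close> show ?thesis by blast
qed

text \<open>
  After $k$ steps the abscissa is of order $X_0 R^k$.
\<close>

lemma R_power_negligible: "((\<lambda>t. R t ^ k / X k t) \<longlongrightarrow> 0) F"
proof (induction k)
  case 0
  show ?case using tendsto_inverse_X[OF X0] by simp
next
  case (Suc k)
  have "((\<lambda>t. X k t * R t / X (Suc k) t) \<longlongrightarrow> 1 / \<rho> k) F"
    using orbit_asymptotics[of k] by (intro orbit_step(4)) auto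
  from tendsto_mult[OF Suc this]
  have "((\<lambda>t. R t ^ k / X k t * (X k t * R t / X (Suc k) t)) \<longlongrightarrow> 0) F" by simp
  moreover have "\<forall>\<^sub>F t in F. R t ^ k / X k t * (X k t * R t / X (Suc k) t) = R t ^ Suc k / X (Suc k) t"
    using filterlim_at_infinity_imp_eventually_ne[of "X k" F 0] orbit_asymptotics[of k]
    by (auto elim!: eventually_mono)
  ultimately show ?case by (rule Lim_transform_eventually)
qed

text \<open>
  The slope deviates from its limit by at least a multiple of $1/R$, and $R^k$ is negligible
  against $X_k$, so \<open>poly_eventually_nonzero_near_direction\<close> applies.
\<close>

theorem orbit_leaves_curve:
  assumes V0: "\<forall>\<^sub>F t in F. 0 \<le> V 0 t" and Q: "Q \<noteq> 0" "degree Q \<le> k" and k: "0 < k"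
  shows "\<forall>\<^sub>F t in F. poly_xy Q (X k t) (Y k t) \<noteq> 0"
proof -
  have nonneg: "\<forall>\<^sub>F t in F. 0 \<le> (-1) ^ j * V j t" for j
  proof (induction j)
    case (Suc j)
    from V_alternates[OF this] show ?case by (auto elim!: eventually_mono)
  qed (use V0 in simp)
  obtain j where j: "k = Suc j" using k gr0_implies_Suc by blast
  obtain \<delta> where \<delta>: "\<delta> > 0" "\<forall>\<^sub>F t in F. \<delta> \<le> (-1) ^ k * V k t"
    using V_alternates[OF nonneg[of j]] unfolding j by blast
  have X: "filterlim (X k) at_infinity F" and Y: "((\<lambda>t. Y k t / X k t) \<longlongrightarrow> slope k) F"
    using orbit_asymptotics[of k] by auto
  have ne: "\<forall>\<^sub>F t in F. X k t \<noteq> 0" by (rule filterlim_at_infinity_imp_eventually_ne[OF X])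
  have "((\<lambda>t. X j t * R t / X k t / X j t) \<longlongrightarrow> 0) F"
    unfolding j using orbit_asymptotics[of j] by (intro tendsto_divide_0[OF orbit_step(4)]) auto
  moreover have "\<forall>\<^sub>F t in F. X j t * R t / X k t / X j t = R t / X k t"
    using filterlim_at_infinity_imp_eventually_ne[of "X j" F 0] orbit_asymptotics[of j]
    by (auto elim!: eventually_mono)
  ultimately have "((\<lambda>t. R t / X k t) \<longlongrightarrow> 0) F" by (rule Lim_transform_eventually)
  then have "\<forall>\<^sub>F t in F. \<bar>R t / X k t\<bar> < \<delta> / 2"
    by (intro order_tendstoD(2)[OF tendsto_rabs_zero]) (use \<delta> in auto)
  then have away: "\<forall>\<^sub>F t in F. \<delta> / 2 \<le> \<bar>Y k t / X k t - slope k\<bar> * \<bar>R t\<bar>"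
    using \<delta>(2) ne
  proof eventually_elim
    case (elim t)
    have "(Y k t / X k t - slope k) * R t = V k t - R t / X k t"
      using elim by (simp add: V_def field_simps)
    moreover have "\<delta> \<le> \<bar>V k t\<bar>" using elim by (cases "even k") auto
    moreover have "\<bar>V k t\<bar> \<le> \<bar>V k t - R t / X k t\<bar> + \<bar>R t / X k t\<bar>" by linarith
    ultimately have "\<delta> / 2 \<le> \<bar>(Y k t / X k t - slope k) * R t\<bar>" using elim(1) by linarith
    then show ?case by (simp only: abs_mult)
  qed
  have "\<forall>\<^sub>F t in F. poly_xy Q (X k t) (Y k t / X k t * X k t) \<noteq> 0"
    using poly_eventually_nonzero_near_direction[OF Q X Y R_at_infinity R_power_negligible _ away] \<delta>
    by simp
  then show ?thesis using ne by eventually_elim simp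
qed

end

context trisector_pair
begin

text \<open>
  It remains to see that $V_0$ is not negative. Its sign is that of $(1 + f(x) - \kappa x) R$,
  and $R$ has the sign of the denominator $D_0$ for large $x$; so this is
  \<open>asymptote_side\<close>.
\<close>

lemma forward_orbit_leaves_curve:
  assumes "Q \<noteq> 0" "degree Q \<le> k" "0 < k"
  shows "\<forall>\<^sub>F x in at_top. regular_orbit k (jet f x) \<and> \<not> on_curve Q ((advance ^^ k) (jet f x))"
proof -
  obtain \<kappa> where \<kappa>: "0 < \<kappa>" "\<And>x. deriv f x \<le> \<kappa>" "(deriv f \<longlongrightarrow> \<kappa>) at_top"
    "((\<lambda>x. f x / x) \<longlongrightarrow> \<kappa>) at_top" using asymptotic_slope by blast
  define X where "X k x = fst ((advance ^^ k) (jet f x))" for k x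
  define Y where "Y k x = fst (snd ((advance ^^ k) (jet f x)))" for k x
  define P where "P k x = snd (snd ((advance ^^ k) (jet f x)))" for k x
  have XYP: "(X k x, Y k x, P k x) = (advance ^^ k) (jet f x)" for k x
    by (simp add: X_def Y_def P_def)
  have zero: "X 0 = (\<lambda>x. x)" "Y 0 = f" "P 0 = deriv f"
    by (auto simp: X_def Y_def P_def jet_def)
  interpret escaping_orbit at_top X Y P \<kappa>
  proof
    show "(X (Suc k) t, Y (Suc k) t, P (Suc k) t) = advance (X k t, Y k t, P k t)" for k t
      unfolding XYP by simp
    show "filterlim (X 0) at_infinity at_top"
      unfolding zero by (intro filterlim_at_top_imp_at_infinity filterlim_ident)
  qed (use \<kappa> tangent_misses_opposite_point in \<open>simp_all add: zero\<close>)
  have V0: "\<forall>\<^sub>F x in at_top. 0 \<le> V 0 x"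
  proof -
    have R1: "\<forall>\<^sub>F x in at_top. 1 \<le> \<bar>R x\<bar>"
      using R_at_infinity unfolding filterlim_at_infinity[OF order_refl] real_norm_def
      by (auto dest: spec[of _ 1])
    have p: "\<forall>\<^sub>F x in at_top. 0 < deriv f x" by (rule order_tendstoD(1)[OF \<kappa>(3,1)])
    show ?thesis
      using R1 p eventually_gt_at_top[of 0] asymptote_side[OF \<kappa>(2,3)] tangent_misses_opposite_point
    proof eventually_elim
      case (elim x)
      define d where "d = 1 + f x - x * deriv f x"
      define N where "N = deriv f x * (1 + (1 / x + f x / x)\<^sup>2) / 2"
      have N: "N > 0" using elim by (simp add: N_def add_pos_nonneg)
      have d: "d \<noteq> 0" "D 0 x = d" using elim by (auto simp: d_def D_def zero)
      have R: "R x = 1 + N * x / d"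
        using X_ratio[of 0 x] elim d by (simp add: R_def zero N_def)
      have V: "V 0 x = (1 + f x - \<kappa> * x) * R x / x" by (simp add: V_def slope_def zero)
      have "0 \<le> (1 + f x - \<kappa> * x) * R x"
      proof (cases "d > 0")
        case True
        then have "0 \<le> 1 + f x - \<kappa> * x" using elim by (simp add: zero_le_mult_iff flip: d_def)
        moreover have "0 \<le> R x" using R N True elim by (simp add: add_nonneg_nonneg)
        ultimately show ?thesis by simp
      next
        case False
        then have neg: "d < 0" using d by simp
        then have "1 + f x - \<kappa> * x \<le> 0" using elim by (auto simp: zero_le_mult_iff simp flip: d_def)
        moreover have "N * x / d < 0" using N neg elim by (simp add: divide_pos_neg)
        then have "R x \<le> 0" using R elim by linarith
        ultimately show ?thesis by (simp add: mult_nonpos_nonpos)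
      qed
      then show ?case using V elim by simp
    qed
  qed
  have regular: "\<forall>\<^sub>F x in at_top. regular_orbit k (jet f x)" for k
  proof -
    have "\<forall>\<^sub>F x in at_top. regular ((advance ^^ i) (jet f x))" for i
    proof -
      note A = orbit_asymptotics[of i]
      have "\<forall>\<^sub>F x in at_top. 1 + Y i x \<noteq> 0" using A by (intro one_plus_Y_ratio(2)) auto
      moreover have "\<forall>\<^sub>F x in at_top. D i x \<noteq> 0" using A by blast
      ultimately show ?thesis
        by eventually_elim (simp add: D_def flip: XYP)
    qed
    then have "\<forall>\<^sub>F x in at_top. \<forall>i\<in>{..<k}. regular ((advance ^^ i) (jet f x))"
      by (intro eventually_ball_finite) auto
    then show ?thesis by (simp add: regular_orbit_def Ball_def)
  qed
  from orbit_leaves_curve[OF V0 assms] regular[of k] show ?thesis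
    by eventually_elim (simp flip: XYP)
qed

end

section \<open>Polynomials in two variables and their common zeros\<close>

lemma poly_xy_ring_hom [simp]:
  "poly_xy 0 x y = 0" "poly_xy 1 x y = 1"
  "poly_xy (P + Q) x y = poly_xy P x y + poly_xy Q x y"
  "poly_xy (P - Q) x y = poly_xy P x y - poly_xy Q x y"
  "poly_xy (- P) x y = - poly_xy P x y"
  "poly_xy (P * Q) x y = poly_xy P x y * poly_xy Q x y"
  "poly_xy (P ^ n) x y = poly_xy P x y ^ n"
  "poly_xy (numeral m) x y = numeral m"
  "poly_xy [:c:] x y = poly c x"
  "poly_xy [:0, 1:] x y = y"
  "poly_xy (smult c P) x y = poly c x * poly_xy P x y"
  by (simp_all add: poly_xy_def)

lemma poly_xy_pCons: "poly_xy (pCons c P) x y = poly c x + y * poly_xy P x y"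
  by (simp add: poly_xy_def)

lemma poly_xy_sum: "poly_xy (\<Sum>i\<in>A. P i) x y = (\<Sum>i\<in>A. poly_xy (P i) x y)"
  by (induction A rule: infinite_finite_induct) auto

lemma poly_xy_dvd: "P dvd Q \<Longrightarrow> poly_xy P x y = 0 \<Longrightarrow> poly_xy Q x y = 0"
  by (auto elim: dvdE)

lemma poly_xy_prod_mset_eq_0:
  "poly_xy (prod_mset M) x y = 0 \<Longrightarrow> \<exists>P\<in>#M. poly_xy P x y = 0"
  by (induction M) auto

lemma poly_xy_prod_eq_0_iff:
  "finite B \<Longrightarrow> poly_xy (\<Prod>B) x y = 0 \<longleftrightarrow> (\<exists>P\<in>B. poly_xy P x y = 0)"
  by (induction B rule: finite_induct) auto

text \<open>
  A nonzero element $H$ of least degree in the ideal generated by $P$ and $Q$ divides both of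
  them up to factors that are free of $y$, by pseudo-division. If $H$ had positive degree,
  primality of $P$ would make $P$ a divisor of $H$ and hence of $Q$.
\<close>

lemma elimination:
  fixes P Q :: "real poly poly"
  assumes P: "prime_elem P" and ndvd: "\<not> P dvd Q"
  obtains U V r where "r \<noteq> 0" "U * P + V * Q = [:r:]"
proof (cases "degree P = 0")
  case True
  then obtain c where c: "P = [:c:]" by (rule degree_eq_zeroE)
  then have "c \<noteq> 0" using P by auto
  then show thesis using that[of c 1 0] c by simp
next
  case False
  define I where "I = {H. \<exists>U V. H = U * P + V * Q}"
  have "P = 1 * P + 0 * Q" "Q = 0 * P + 1 * Q" by simp_all
  then have mem: "P \<in> I" "Q \<in> I" unfolding I_def by blast+
  have closed: "smult a F - H * q \<in> I" if FH: "F \<in> I" "H \<in> I" for F H q a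
  proof -
    obtain U V U' V' where "F = U * P + V * Q" "H = U' * P + V' * Q"
      using FH unfolding I_def by blast
    then have "smult a F - H * q = ([:a:] * U - U' * q) * P + ([:a:] * V - V' * q) * Q"
      by (simp add: algebra_simps smult_add_right)
    then show ?thesis unfolding I_def by blast
  qed
  have "P \<in> I \<and> P \<noteq> 0" using mem P by auto
  from ex_has_least_nat[of "\<lambda>F. F \<in> I \<and> F \<noteq> 0", OF this, of degree]
  obtain H where H: "H \<in> I" "H \<noteq> 0" and min: "\<And>F. F \<in> I \<Longrightarrow> F \<noteq> 0 \<Longrightarrow> degree H \<le> degree F"
    by blast
  have quotient: "\<exists>a q. a \<noteq> 0 \<and> smult a F = H * q" if "F \<in> I" for F
  proof -
    obtain a q where aq: "a \<noteq> 0" "smult a F = H * q + pseudo_mod F H"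
      and r: "pseudo_mod F H = 0 \<or> degree (pseudo_mod F H) < degree H"
      using pseudo_mod[OF H(2)] by blast
    have "pseudo_mod F H = smult a F - H * q" using aq by simp
    then have "pseudo_mod F H \<in> I" using closed[OF that H(1)] by simp
    then have "pseudo_mod F H = 0" using r min not_le by blast
    then show ?thesis using aq by auto
  qed
  obtain a q where aq: "a \<noteq> 0" "smult a P = H * q" using quotient[OF mem(1)] by blast
  then have "P dvd H * q" by (metis dvd_smult dvd_refl)
  then consider "P dvd H" | "P dvd q" using P prime_elem_dvd_mult_iff by blast
  then have "degree H = 0"
  proof cases
    case 1
    obtain b q' where b: "b \<noteq> 0" "smult b Q = H * q'" using quotient[OF mem(2)] by blast
    then have "P dvd [:b:] * Q" using 1 by simp
    then have "P dvd [:b:]" using P ndvd prime_elem_dvd_mult_iff by blast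
    then have "degree P \<le> degree [:b:]" using b by (intro dvd_imp_degree_le) auto
    then show ?thesis using False by simp
  next
    case 2
    then obtain q' where "q = P * q'" by (rule dvdE)
    then have "P * [:a:] = P * (H * q')" using aq by (simp add: mult_ac)
    then have "[:a:] = H * q'" using P by (metis mult_left_cancel not_prime_elem_zero)
    then have "degree (H * q') = 0" "q' \<noteq> 0" using aq(1) by (metis degree_pCons_0, auto)
    then show ?thesis using H(2) by (simp add: degree_mult_eq)
  qed
  then obtain r where r: "H = [:r:]" by (rule degree_eq_zeroE)
  moreover obtain U V where "H = U * P + V * Q" using H(1) unfolding I_def by blast
  ultimately show thesis using that[of r U V] H(2) by auto
qed

lemma finite_common_zeros:
  assumes "prime_elem P" "\<not> P dvd Q"
  shows "finite {x. \<exists>y. poly_xy P x y = 0 \<and> poly_xy Q x y = 0}"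
proof -
  obtain U V r where r: "r \<noteq> 0" "U * P + V * Q = [:r:]" using elimination[OF assms] .
  have "poly r x = 0" if "poly_xy P x y = 0" "poly_xy Q x y = 0" for x y
  proof -
    have "poly r x = poly_xy (U * P + V * Q) x y" by (simp add: r(2))
    then show ?thesis using that by simp
  qed
  then have "{x. \<exists>y. poly_xy P x y = 0 \<and> poly_xy Q x y = 0} \<subseteq> {x. poly r x = 0}" by blast
  then show ?thesis using poly_roots_finite[OF r(1)] by (rule finite_subset)
qed

lemma has_derivative_along_graph:
  assumes f: "(f has_real_derivative p) (at x)"
  shows "((\<lambda>x. poly_xy P x (f x)) has_real_derivative
    poly_xy (map_poly pderiv P) x (f x) + p * poly_xy (pderiv P) x (f x)) (at x)"
proof (induction P)
  case (pCons c P)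
  have "((\<lambda>x. poly c x + f x * poly_xy P x (f x)) has_real_derivative
      poly (pderiv c) x + (p * poly_xy P x (f x)
        + (poly_xy (map_poly pderiv P) x (f x) + p * poly_xy (pderiv P) x (f x)) * f x)) (at x)"
    by (intro DERIV_add poly_DERIV DERIV_mult f pCons)
  moreover have "poly_xy (map_poly pderiv (pCons c P)) x (f x)
      = poly (pderiv c) x + f x * poly_xy (map_poly pderiv P) x (f x)"
    by (simp only: map_poly_pCons pderiv_0 poly_xy_pCons)
  moreover have "poly_xy (pderiv (pCons c P)) x (f x) = poly_xy P x (f x) + f x * poly_xy (pderiv P) x (f x)"
    by (simp only: pderiv_pCons poly_xy_ring_hom poly_xy_pCons) simp
  ultimately show ?case by (simp only: poly_xy_pCons) (simp only: algebra_simps)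
qed (simp add: poly_xy_def)

lemma prime_on_curve_degree:
  assumes "prime_elem b" "infinite {x. \<exists>y. poly_xy b x y = 0}"
  shows "0 < degree b"
proof (rule ccontr)
  assume "\<not> 0 < degree b"
  then obtain c where c: "b = [:c:]" by (meson degree_eq_zeroE gr0I)
  then have "c \<noteq> 0" using assms by auto
  then have "finite {x. poly c x = 0}" by (rule poly_roots_finite)
  then show False using assms(2) by (simp add: c)
qed

text \<open>
  Of the prime factors of $P$ keep those that vanish at infinitely many points of the graph.
  Their product vanishes on the graph up to finitely many points, hence everywhere by
  continuity. None of these primes divides the $y$-derivative of the product, which therefore
  vanishes at finitely many points of the graph only.
\<close>

lemma squarefree_equation:
  assumes P: "P \<noteq> 0" "\<And>x. poly_xy P x (f x) = 0" and f: "continuous_on UNIV f"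
  obtains B where "finite B" "\<And>b. b \<in> B \<Longrightarrow> prime b"
    "\<And>x. \<exists>b\<in>B. poly_xy b x (f x) = 0"
    "finite {x. poly_xy (pderiv (\<Prod>B)) x (f x) = 0}"
proof -
  define B where "B = {b \<in> prime_factors P. infinite {x. poly_xy b x (f x) = 0}}"
  have B: "finite B" "prime b" "infinite {x. poly_xy b x (f x) = 0}" if "b \<in> B" for b
    using that by (auto simp: B_def intro: in_prime_factors_imp_prime)
  have finB: "finite B" by (simp add: B_def)
  have cover: "\<exists>b\<in>B. poly_xy b x (f x) = 0" for x
  proof -
    define Z where "Z = (\<Union>b\<in>prime_factors P - B. {x. poly_xy b x (f x) = 0})"
    have Z: "finite Z" unfolding Z_def by (intro finite_UN_I) (auto simp: B_def)
    have "poly_xy (\<Prod>B) x (f x) = 0" if "x \<notin> Z" for x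
    proof -
      have "P dvd prod_mset (prime_factorization P)"
        using prod_mset_prime_factorization_weak[OF P(1)] by (metis associated_iff_dvd)
      then have "poly_xy (prod_mset (prime_factorization P)) x (f x) = 0"
        using P(2) by (rule poly_xy_dvd)
      from poly_xy_prod_mset_eq_0[OF this]
      obtain b where "b \<in> prime_factors P" "poly_xy b x (f x) = 0" by blast
      then have "b \<in> B" using that by (auto simp: Z_def)
      then show ?thesis using \<open>poly_xy b x (f x) = 0\<close> finB poly_xy_prod_eq_0_iff by blast
    qed
    then have "{x. poly_xy (\<Prod>B) x (f x) \<noteq> 0} \<subseteq> Z" by blast
    then have "finite {x. poly_xy (\<Prod>B) x (f x) \<noteq> 0}" using Z finite_subset by blast
    moreover have "open {x. poly_xy (\<Prod>B) x (f x) \<noteq> 0}"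
    proof (intro open_Collect_neq continuous_intros)
      show "continuous_on UNIV (\<lambda>x. poly_xy (\<Prod>B) x (f x))"
        unfolding poly_xy_altdef by (intro continuous_intros f)
    qed
    ultimately have "{x. poly_xy (\<Prod>B) x (f x) \<noteq> 0} = {}"
      using finite_imp_not_open by blast
    then have "poly_xy (\<Prod>B) x (f x) = 0" by blast
    then show ?thesis using poly_xy_prod_eq_0_iff[OF finB] by blast
  qed
  have "finite {x. poly_xy b x (f x) = 0 \<and> poly_xy (pderiv (\<Prod>B)) x (f x) = 0}" if b: "b \<in> B" for b
  proof -
    have prime: "prime_elem b" using B(2)[OF b] by simp
    have "\<not> b dvd pderiv (\<Prod>B)"
    proof
      define H where "H = \<Prod>(B - {b})"
      have "\<Prod>B = b * H" unfolding H_def using finB b by (simp add: prod.remove)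
      moreover assume "b dvd pderiv (\<Prod>B)"
      ultimately have "b dvd pderiv b * H"
        by (metis dvd_add_right_iff dvd_triv_left mult.commute pderiv_mult)
      then consider "b dvd pderiv b" | "b dvd H"
        using prime prime_elem_dvd_mult_iff by blast
      then show False
      proof cases
        case 1
        have "{x. poly_xy b x (f x) = 0} \<subseteq> {x. \<exists>y. poly_xy b x y = 0}" by blast
        then have deg: "0 < degree b"
          using prime_on_curve_degree[OF prime] B(3)[OF b] finite_subset by blast
        then have "pderiv b \<noteq> 0" by (simp add: pderiv_eq_0_iff)
        from dvd_imp_degree_le[OF 1 this] show False using deg by (simp add: degree_pderiv)
      next
        case 2
        then obtain c where "c \<in> B - {b}" "b dvd c"
          using prime_dvd_prod_iff[of "B - {b}" b "\<lambda>c. c"] B(2)[OF b] finB by (auto simp: H_def)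
        then show False using primes_dvd_imp_eq[of b c] B(2) b by auto
      qed
    qed
    from finite_common_zeros[OF prime this] show ?thesis
      by (rule rev_finite_subset) blast
  qed
  then have "finite (\<Union>b\<in>B. {x. poly_xy b x (f x) = 0 \<and> poly_xy (pderiv (\<Prod>B)) x (f x) = 0})"
    using finB by (intro finite_UN_I)
  moreover have "{x. poly_xy (pderiv (\<Prod>B)) x (f x) = 0} \<subseteq>
      (\<Union>b\<in>B. {x. poly_xy b x (f x) = 0 \<and> poly_xy (pderiv (\<Prod>B)) x (f x) = 0})"
    using cover by blast
  ultimately have "finite {x. poly_xy (pderiv (\<Prod>B)) x (f x) = 0}" using finite_subset by blast
  then show thesis using that finB B(2) cover by blast
qed

section \<open>Iterates as rational maps\<close>

text \<open>
  The map \<open>advance\<close> in homogeneous coordinates $(A, B, E, C)$ for $(A/C, B/C,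
  E/C)$. It makes sense over every commutative ring, and so it can be iterated on polynomials
  and evaluated afterwards.
\<close>

fun advance_hom :: "'a::comm_ring_1 \<times> 'a \<times> 'a \<times> 'a \<Rightarrow> 'a \<times> 'a \<times> 'a \<times> 'a"
  where "advance_hom (A, B, E, C) =
    (let \<Delta> = (C + B) * C - A * E; S = A\<^sup>2 + (C + B)\<^sup>2 in
      ((2 * \<Delta> * A + S * E) * (C + B), (S * C - 2 * \<Delta> * B) * (C + B),
        2 * \<Delta> * C * A, 2 * \<Delta> * C * (C + B)))"

fun represents :: "real \<times> real \<times> real \<times> real \<Rightarrow> real \<times> real \<times> real \<Rightarrow> bool"
  where "represents (A, B, E, C) (x, y, p) \<longleftrightarrow> C \<noteq> 0 \<and> A = x * C \<and> B = y * C \<and> E = p * C"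

fun eval_tuple where
  "eval_tuple x y (A, B, E, C) = (poly_xy A x y, poly_xy B x y, poly_xy E x y, poly_xy C x y)"

lemma eval_advance_hom: "eval_tuple x y (advance_hom h) = advance_hom (eval_tuple x y h)"
  by (cases h) (simp add: Let_def)

lemma eval_advance_hom_iterate:
  "eval_tuple x y ((advance_hom ^^ k) h) = (advance_hom ^^ k) (eval_tuple x y h)"
  by (induction k) (simp_all add: eval_advance_hom)

lemma represents_advance_hom:
  assumes "represents h v" "regular v"
  shows "represents (advance_hom h) (advance v)"
proof -
  obtain A B E C where h: "h = (A, B, E, C)" by (cases h)
  obtain x y p where v: "v = (x, y, p)" by (cases v)
  have C: "C \<noteq> 0" and eq: "A = x * C" "B = y * C" "E = p * C" using assms by (auto simp: h v)
  have ne: "1 + y \<noteq> 0" "1 + y - x * p \<noteq> 0" using assms by (auto simp: v)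
  define D where "D = 1 + y - x * p"
  define s where "s = (x\<^sup>2 + (1 + y)\<^sup>2) / (2 * D)"
  define \<Delta> where "\<Delta> = (C + B) * C - A * E"
  have \<Delta>: "\<Delta> = D * C\<^sup>2" by (simp add: \<Delta>_def eq D_def power2_eq_square algebra_simps)
  have CB: "C + B = (1 + y) * C" by (simp add: eq algebra_simps)
  have sD: "s * (2 * D) = x\<^sup>2 + (1 + y)\<^sup>2" using ne by (simp add: s_def D_def)
  have S: "A\<^sup>2 + (C + B)\<^sup>2 = s * (2 * D) * C\<^sup>2"
    unfolding CB eq(1) sD by (simp only: power_mult_distrib distrib_right[of "x\<^sup>2" "(1 + y)\<^sup>2"])
  have q: "x = x / (1 + y) * (1 + y)" using ne by simp
  have adv: "advance v = (x + s * p, s - y, x / (1 + y))" by (simp add: v s_def D_def Let_def)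
  have "2 * \<Delta> * C * (C + B) \<noteq> 0" unfolding CB \<Delta> using ne C by (simp add: D_def)
  moreover have "(2 * \<Delta> * A + (A\<^sup>2 + (C + B)\<^sup>2) * E) * (C + B) = (x + s * p) * (2 * \<Delta> * C * (C + B))"
    unfolding S \<Delta> unfolding eq(1,3) by (simp add: power2_eq_square algebra_simps)
  moreover have "((A\<^sup>2 + (C + B)\<^sup>2) * C - 2 * \<Delta> * B) * (C + B) = (s - y) * (2 * \<Delta> * C * (C + B))"
    unfolding S \<Delta> unfolding eq(2) by (simp add: power2_eq_square algebra_simps)
  moreover have "2 * \<Delta> * C * A = x / (1 + y) * (2 * \<Delta> * C * (C + B))"
    unfolding CB using ne by (simp add: eq(1))
  ultimately show ?thesis unfolding adv h by (simp add: Let_def \<Delta>_def)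
qed

lemma represents_advance_hom_iterate:
  assumes "represents h v" "regular_orbit k v"
  shows "represents ((advance_hom ^^ k) h) ((advance ^^ k) v)"
  using assms(2)
proof (induction k)
  case (Suc k)
  then show ?case using represents_advance_hom by (simp add: regular_orbit_def)
qed (use assms(1) in simp)

text \<open>
  The value of $Q(A/C, B/C)$ multiplied by a power of $C$ that clears all denominators.
\<close>

fun homogenize :: "real poly poly \<Rightarrow> real poly poly \<times> real poly poly \<times> real poly poly \<times> real poly poly \<Rightarrow> real poly poly"
  where "homogenize Q (A, B, E, C) = (let d = Max ((\<lambda>j. degree (coeff Q j)) ` {..degree Q}) in
    \<Sum>j\<le>degree Q. \<Sum>i\<le>d. [:[:coeff (coeff Q j) i:]:] * A ^ i * B ^ j * C ^ ((d - i) + (degree Q - j)))"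

lemma homogenize_eq_0_iff:
  assumes "represents (eval_tuple x y h) v"
  shows "poly_xy (homogenize Q h) x y = 0 \<longleftrightarrow> on_curve Q v"
proof -
  obtain A B E C where h: "h = (A, B, E, C)" by (cases h)
  obtain u w p where v: "v = (u, w, p)" by (cases v)
  define c where "c = poly_xy C x y"
  have eq: "poly_xy A x y = u * c" "poly_xy B x y = w * c" and c: "c \<noteq> 0"
    using assms by (auto simp: h v c_def)
  define d where "d = Max ((\<lambda>j. degree (coeff Q j)) ` {..degree Q})"
  have d: "degree (coeff Q j) \<le> d" if "j \<le> degree Q" for j
    unfolding d_def using that by (intro Max_ge) auto
  have inner: "poly (coeff Q j) u = (\<Sum>i\<le>d. coeff (coeff Q j) i * u ^ i)" if "j \<le> degree Q" for j
    unfolding poly_altdef using d[OF that] by (intro sum.mono_neutral_left) (auto simp: coeff_eq_0)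
  have "poly_xy (homogenize Q h) x y = (\<Sum>j\<le>degree Q. \<Sum>i\<le>d.
      coeff (coeff Q j) i * (u * c) ^ i * (w * c) ^ j * c ^ ((d - i) + (degree Q - j)))"
    by (simp add: h poly_xy_sum eq mult.assoc flip: d_def c_def)
  also have "\<dots> = (\<Sum>j\<le>degree Q. \<Sum>i\<le>d. coeff (coeff Q j) i * u ^ i * w ^ j * c ^ (d + degree Q))"
  proof (intro sum.cong refl)
    fix i j assume "j \<in> {..degree Q}" "i \<in> {..d}"
    then have "d + degree Q = i + j + ((d - i) + (degree Q - j))" by simp
    then have "c ^ (d + degree Q) = c ^ i * c ^ j * c ^ ((d - i) + (degree Q - j))"
      by (metis power_add)
    then show "coeff (coeff Q j) i * (u * c) ^ i * (w * c) ^ j * c ^ ((d - i) + (degree Q - j))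
        = coeff (coeff Q j) i * u ^ i * w ^ j * c ^ (d + degree Q)"
      by (simp add: power_mult_distrib mult_ac)
  qed
  also have "\<dots> = poly_xy Q u w * c ^ (d + degree Q)"
    unfolding poly_xy_altdef using inner by (simp add: sum_distrib_right)
  finally show ?thesis using c by (simp add: v)
qed

text \<open>
  The point $(x, y)$ and the slope $- G_x / G_y$ of the curve $G = 0$ there, with common
  denominator $G_y$.
\<close>

definition jet_tuple :: "real poly poly \<Rightarrow> real poly poly \<times> real poly poly \<times> real poly poly \<times> real poly poly"
  where "jet_tuple G = ([:[:0, 1:]:] * pderiv G, [:0, 1:] * pderiv G, - map_poly pderiv G, pderiv G)"

definition tangent_at :: "real poly poly \<Rightarrow> real \<times> real \<times> real \<Rightarrow> bool"
  where "tangent_at G v = (case v of (x, y, p) \<Rightarrow> poly_xy (pderiv G) x y \<noteq> 0 \<and>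
    poly_xy (map_poly pderiv G) x y + p * poly_xy (pderiv G) x y = 0)"

lemma represents_jet_tuple:
  "tangent_at G (x, y, p) \<Longrightarrow> represents (eval_tuple x y (jet_tuple G)) (x, y, p)"
  by (auto simp: jet_tuple_def tangent_at_def poly_xy_pCons)

text \<open>
  With slopes taken from the curve $G = 0$, the condition that the $k$-th iterate lies on the
  curve $c = 0$ is a polynomial equation in the starting point. If it holds at infinitely many
  points of the irreducible curve $b = 0$, then $b$ divides that polynomial.
\<close>

lemma incidence_spreads:
  assumes b: "prime_elem b" and inf: "infinite (fst ` S)"
    and S: "\<And>v. v \<in> S \<Longrightarrow> on_curve b v \<and> tangent_at G v \<and> regular_orbit k v \<and> on_curve c ((advance ^^ k) v)"
    and v: "on_curve b v" "tangent_at G v" "regular_orbit k v"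
  shows "on_curve c ((advance ^^ k) v)"
proof -
  define Q where "Q = homogenize c ((advance_hom ^^ k) (jet_tuple G))"
  have Q: "poly_xy Q (fst u) (fst (snd u)) = 0 \<longleftrightarrow> on_curve c ((advance ^^ k) u)"
    if "tangent_at G u" "regular_orbit k u" for u
  proof -
    obtain x y p where u: "u = (x, y, p)" by (cases u)
    have "represents (eval_tuple x y (jet_tuple G)) u"
      using represents_jet_tuple that by (simp add: u)
    then have "represents (eval_tuple x y ((advance_hom ^^ k) (jet_tuple G))) ((advance ^^ k) u)"
      unfolding eval_advance_hom_iterate by (rule represents_advance_hom_iterate) (rule that)
    from homogenize_eq_0_iff[OF this, of c] show ?thesis by (simp add: Q_def u)
  qed
  have "fst ` S \<subseteq> {x. \<exists>y. poly_xy b x y = 0 \<and> poly_xy Q x y = 0}"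
    using S Q by blast
  then have "b dvd Q" using finite_common_zeros[OF b] inf finite_subset by blast
  then show ?thesis using Q poly_xy_dvd v by blast
qed

lemma regular_orbit_add:
  "regular_orbit (m + n) v \<longleftrightarrow> regular_orbit m v \<and> regular_orbit n ((advance ^^ m) v)"
proof
  assume *: "regular_orbit (m + n) v"
  have "regular ((advance ^^ i) ((advance ^^ m) v))" if "i < n" for i
    using * that unfolding regular_orbit_def by (metis add.commute comp_apply funpow_add nat_add_left_cancel_less)
  then show "regular_orbit m v \<and> regular_orbit n ((advance ^^ m) v)"
    using * by (simp add: regular_orbit_def)
next
  assume *: "regular_orbit m v \<and> regular_orbit n ((advance ^^ m) v)"
  show "regular_orbit (m + n) v" unfolding regular_orbit_def
  proof (intro allI impI)
    fix i assume "i < m + n"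
    show "regular ((advance ^^ i) v)"
    proof (cases "i < m")
      case False
      then have "(advance ^^ i) v = (advance ^^ (i - m)) ((advance ^^ m) v)"
        by (simp flip: funpow_add comp_apply[of "advance ^^ (i - m)" "advance ^^ m"])
      then show ?thesis using * False \<open>i < m + n\<close> by (simp add: regular_orbit_def)
    qed (use * in \<open>simp add: regular_orbit_def\<close>)
  qed
qed

section \<open>The forward and the backward orbit on one component\<close>

context trisector_pair
begin

text \<open>
  The map \<open>\<theta>\<close> is the foot of the foot. It is injective because
  \<open>advance\<close> undoes it.
\<close>

lemma backward_orbit:
  "\<exists>\<theta>. inj \<theta> \<and> (\<forall>j x. regular_orbit (2 * j) (jet f ((\<theta> ^^ j) x)) \<and>
    (advance ^^ (2 * j)) (jet f ((\<theta> ^^ j) x)) = jet f x)"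
proof -
  obtain \<theta> where \<theta>: "\<And>x. regular (jet f (\<theta> x))" "\<And>x. regular (advance (jet f (\<theta> x)))"
    "\<And>x. (advance ^^ 2) (jet f (\<theta> x)) = jet f x"
    using double_foot by metis
  have "inj \<theta>"
  proof
    fix x y assume "\<theta> x = \<theta> y"
    then have "jet f x = jet f y" using \<theta>(3) by metis
    then show "x = y" by (simp add: jet_def)
  qed
  moreover have "regular_orbit (2 * j) (jet f ((\<theta> ^^ j) x)) \<and>
      (advance ^^ (2 * j)) (jet f ((\<theta> ^^ j) x)) = jet f x" for j x
  proof (induction j)
    case (Suc j)
    have "regular_orbit 2 (jet f (\<theta> y))" for y
      using \<theta>(1,2) by (simp add: regular_orbit_def numeral_2_eq_2 less_Suc_eq)
    moreover have "2 * Suc j = 2 + 2 * j" by simp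
    ultimately have "regular_orbit (2 * Suc j) (jet f ((\<theta> ^^ Suc j) x))"
      using Suc \<theta>(3) by (simp only: regular_orbit_add) simp
    moreover have "advance ^^ (2 * Suc j) = advance ^^ (2 * j) \<circ> advance ^^ 2"
      by (simp only: mult_Suc_right add.commute[of 2] funpow_add)
    then have "(advance ^^ (2 * Suc j)) (jet f ((\<theta> ^^ Suc j) x)) = jet f x"
      using Suc \<theta>(3) by simp
    ultimately show ?case by blast
  qed (simp add: regular_orbit_def)
  ultimately show ?thesis by blast
qed

text \<open>
  Follow the backward orbits of all natural numbers for $J$ steps and record the component that
  each point lies on. Infinitely many starting points share the same record $b_0, \dots, b_J$.
  If $b_{j+1} = b_{j+m+1}$, then also $b_j = b_{j+m}$: by \<open>incidence_spreads\<close> the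
  image under two steps of the common component is contained in both, and distinct irreducible
  curves have only finitely many common points. Hence a repetition can be shifted down to $b_0 =
  b_m$, and this component, which contains points arbitrarily far out, is mapped into itself by
  $2m$ steps.
\<close>

theorem graph_not_algebraic:
  assumes "P \<noteq> 0"
  shows "\<exists>x. poly_xy P x (f x) \<noteq> 0"
proof (rule ccontr)
  assume "\<not> ?thesis"
  moreover have "continuous_on UNIV f"
    using differentiable by (meson DERIV_isCont continuous_at_imp_continuous_on)
  ultimately obtain B where B: "finite B" "\<And>b. b \<in> B \<Longrightarrow> prime b"
    and cover: "\<And>x. \<exists>b\<in>B. poly_xy b x (f x) = 0"
    and singular: "finite {x. poly_xy (pderiv (\<Prod>B)) x (f x) = 0}"
    by (metis squarefree_equation[OF assms])
  define G where "G = \<Prod>B"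
  define Z where "Z = {x. poly_xy (pderiv G) x (f x) = 0}"
  have finZ: "finite Z" using singular by (simp add: Z_def G_def)
  have tangent: "tangent_at G (jet f x)" if "x \<notin> Z" for x
  proof -
    have "poly_xy G x (f x) = 0" for x using cover B(1) by (simp add: G_def poly_xy_prod_eq_0_iff)
    then have "(\<lambda>x. poly_xy G x (f x)) = (\<lambda>x. 0)" by blast
    with has_derivative_along_graph[OF differentiable, of G x]
    have "((\<lambda>x. 0) has_real_derivative
        poly_xy (map_poly pderiv G) x (f x) + deriv f x * poly_xy (pderiv G) x (f x)) (at x)" by simp
    then have "poly_xy (map_poly pderiv G) x (f x) + deriv f x * poly_xy (pderiv G) x (f x) = 0"
      using DERIV_unique DERIV_const by blast
    then show ?thesis using that by (simp add: tangent_at_def jet_def Z_def)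
  qed
  obtain \<theta> where \<theta>: "inj \<theta>"
    "\<And>j x. regular_orbit (2 * j) (jet f ((\<theta> ^^ j) x))"
    "\<And>j x. (advance ^^ (2 * j)) (jet f ((\<theta> ^^ j) x)) = jet f x"
    using backward_orbit by blast
  define \<xi> where "\<xi> j n = (\<theta> ^^ j) (real n)" for j n
  have \<xi>_inj: "inj (\<xi> j)" for j
  proof (rule injI)
    fix n n' assume "\<xi> j n = \<xi> j n'"
    then have "real n = real n'" unfolding \<xi>_def by (rule injD[OF inj_fn[OF \<theta>(1)]])
    then show "n = n'" by simp
  qed
  have \<xi>_orbit: "regular_orbit (2 * i) (jet f (\<xi> (i + j) n))"
    "(advance ^^ (2 * i)) (jet f (\<xi> (i + j) n)) = jet f (\<xi> j n)" for i j n
    using \<theta>(2,3)[of i "\<xi> j n"] by (simp_all add: \<xi>_def funpow_add)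
  define K where "K = Suc (Max (degree ` B))"
  have K: "degree b \<le> K" if "b \<in> B" for b
    using that B(1) by (auto simp: K_def intro: le_SucI)
  define J where "J = K * card B"
  define N where "N = {n. \<forall>j\<le>J. \<xi> j n \<notin> Z}"
  have "finite (\<Union>j\<le>J. \<xi> j -` Z)" using finZ \<xi>_inj by (auto intro!: finite_vimageI)
  moreover have "UNIV - N = (\<Union>j\<le>J. \<xi> j -` Z)" by (auto simp: N_def)
  ultimately have "finite (- N)" by (simp add: Compl_eq_Diff_UNIV)
  then have "infinite N" using finite_compl infinite_UNIV_nat by blast
  define \<beta> where "\<beta> j n = (SOME b. b \<in> B \<and> poly_xy b (\<xi> j n) (f (\<xi> j n)) = 0)" for j n
  have \<beta>: "\<beta> j n \<in> B" "poly_xy (\<beta> j n) (\<xi> j n) (f (\<xi> j n)) = 0" for j n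
  proof -
    have "\<exists>b. b \<in> B \<and> poly_xy b (\<xi> j n) (f (\<xi> j n)) = 0" using cover by blast
    from someI_ex[OF this]
    show "\<beta> j n \<in> B" "poly_xy (\<beta> j n) (\<xi> j n) (f (\<xi> j n)) = 0" by (auto simp: \<beta>_def)
  qed
  define colour where "colour n = map (\<lambda>j. \<beta> j n) [0..<Suc J]" for n
  have "colour ` N \<subseteq> {xs. set xs \<subseteq> B \<and> length xs = Suc J}" using \<beta> by (auto simp: colour_def)
  then have "finite (colour ` N)" using finite_lists_length_eq[OF B(1)] finite_subset by blast
  from pigeonhole_infinite[OF \<open>infinite N\<close> this]
  obtain n0 where n0: "infinite {n \<in> N. colour n = colour n0}" by blast
  define M where "M = {n \<in> N. colour n = colour n0}"
  have M: "infinite M" using n0 by (simp add: M_def)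
  define b where "b j = \<beta> j n0" for j
  have b: "b j \<in> B" "prime (b j)" "prime_elem (b j)" for j
    using \<beta>(1) B(2) by (auto simp: b_def intro: prime_imp_prime_elem)
  have on_b: "on_curve (b j) (jet f (\<xi> j n))" and tangent_\<xi>: "tangent_at G (jet f (\<xi> j n))"
    if "n \<in> M" "j \<le> J" for j n
  proof -
    have "colour n ! j = colour n0 ! j" using that by (simp add: M_def)
    then have "\<beta> j n = b j" using that(2) by (simp add: colour_def b_def del: upt_Suc)
    then show "on_curve (b j) (jet f (\<xi> j n))" using \<beta>(2)[of j n] by (simp add: jet_def)
    show "tangent_at G (jet f (\<xi> j n))" using that by (auto simp: M_def N_def intro: tangent)
  qed
  have inf: "infinite (fst ` (\<lambda>n. jet f (\<xi> j n)) ` M)" for j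
  proof -
    have "fst ` (\<lambda>n. jet f (\<xi> j n)) ` M = \<xi> j ` M" by (simp add: image_image jet_def)
    then show ?thesis using M finite_imageD[OF _ inj_on_subset[OF \<xi>_inj subset_UNIV]] by auto
  qed
  \<comment> \<open>The infinitely many witnesses are the points of the recorded backward orbits.\<close>
  have spread: "on_curve (b i) ((advance ^^ (2 * k)) v)"
    if "i + k \<le> J" "on_curve (b (i + k)) v" "tangent_at G v" "regular_orbit (2 * k) v" for i k v
  proof (rule incidence_spreads[OF b(3) inf _ that(2-4)])
    fix u assume "u \<in> (\<lambda>n. jet f (\<xi> (i + k) n)) ` M"
    then obtain n where n: "n \<in> M" "u = jet f (\<xi> (i + k) n)" by blast
    show "on_curve (b (i + k)) u \<and> tangent_at G u \<and> regular_orbit (2 * k) u \<and>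
        on_curve (b i) ((advance ^^ (2 * k)) u)"
      using on_b[OF n(1)] tangent_\<xi>[OF n(1)] \<xi>_orbit[of k i n] that(1) n(2)
      by (simp add: add.commute)
  qed
  \<comment> \<open>Looking at every K-th index only makes the period m at least K, and so at least the degree in y.\<close>
  have "\<not> inj_on (\<lambda>i. b (K * i)) {..card B}"
  proof
    assume "inj_on (\<lambda>i. b (K * i)) {..card B}"
    then have "card {..card B} \<le> card B" using b(1) B(1) by (intro card_inj_on_le[of _ _ B]) auto
    then show False by simp
  qed
  then obtain i i' where ii: "i < i'" "i' \<le> card B" "b (K * i) = b (K * i')"
    by (auto simp: inj_on_def) (metis linorder_neqE_nat)
  define m where "m = K * (i' - i)"
  have "K * 1 \<le> K * (i' - i)" using ii by (intro mult_le_mono2) simp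
  then have m: "K \<le> m" "0 < m" by (simp_all add: m_def K_def)
  have descend: "b j = b (j + m) \<Longrightarrow> j + m \<le> J \<Longrightarrow> b 0 = b m" for j
  proof (induction j)
    case (Suc j)
    have "poly_xy (b j) (\<xi> (j + m) n) (f (\<xi> (j + m) n)) = 0" if n: "n \<in> M" for n
    proof -
      have "on_curve (b (j + 1)) (jet f (\<xi> (Suc j + m) n))"
        using on_b[OF n Suc.prems(2)] Suc.prems(1) by simp
      then have "on_curve (b j) ((advance ^^ (2 * 1)) (jet f (\<xi> (Suc j + m) n)))"
        using Suc.prems(2) tangent_\<xi>[OF n Suc.prems(2)] \<xi>_orbit(1)[of 1 "j + m" n]
        by (intro spread) auto
      moreover have "(advance ^^ (2 * 1)) (jet f (\<xi> (Suc j + m) n)) = jet f (\<xi> (j + m) n)"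
        using \<xi>_orbit(2)[of 1 "j + m" n] by simp
      ultimately show ?thesis by (simp add: jet_def)
    qed
    then have "\<xi> (j + m) ` M \<subseteq> {x. \<exists>y. poly_xy (b (j + m)) x y = 0 \<and> poly_xy (b j) x y = 0}"
      using on_b[of _ "j + m"] Suc.prems(2) by (fastforce simp: jet_def)
    moreover have "infinite (\<xi> (j + m) ` M)"
      using M finite_imageD[OF _ inj_on_subset[OF \<xi>_inj subset_UNIV]] by auto
    ultimately have "b (j + m) dvd b j"
      using finite_common_zeros[OF b(3)] finite_subset by blast
    then have "b j = b (j + m)" using primes_dvd_imp_eq b(2) by metis
    then show ?case using Suc by simp
  qed simp
  have "K * i + m = K * i'" using ii by (simp add: m_def flip: distrib_left)
  moreover have "K * i' \<le> J" using ii by (simp add: J_def)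
  ultimately have b0: "b 0 = b m" "m \<le> J" using descend[of "K * i"] ii(3) by auto
  have "\<forall>\<^sub>F x in at_top. regular_orbit (2 * m) (jet f x) \<and> \<not> on_curve (b 0) ((advance ^^ (2 * m)) (jet f x))"
  proof (rule forward_orbit_leaves_curve)
    show "b 0 \<noteq> 0" using b(2)[of 0] by auto
    show "degree (b 0) \<le> 2 * m" using K[OF b(1)[of 0]] m by simp
  qed (use m in simp)
  then obtain x0 where x0: "\<And>x. x0 \<le> x \<Longrightarrow>
      regular_orbit (2 * m) (jet f x) \<and> \<not> on_curve (b 0) ((advance ^^ (2 * m)) (jet f x))"
    unfolding eventually_at_top_linorder by blast
  obtain n where n: "n \<in> M" "nat \<lceil>x0\<rceil> \<le> n" using M by (meson infinite_nat_iff_unbounded_le)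
  then have "x0 \<le> real n" by linarith
  moreover have "on_curve (b 0) ((advance ^^ (2 * m)) (jet f (real n)))"
    using spread[of 0 m "jet f (real n)"] on_b[OF n(1), of 0] tangent_\<xi>[OF n(1), of 0] x0[of "real n"]
      b0 \<open>x0 \<le> real n\<close> by (simp add: \<xi>_def)
  ultimately show False using x0 by blast
qed

end

theorem theorem1:
  fixes C\<^sub>1 C\<^sub>2 :: "(real \<times> real) set"
  assumes "distance_trisector_curves (0, 1) (0, -1) C\<^sub>1 C\<^sub>2"
  shows "transcendental_curve C\<^sub>1"
proof
  obtain f g where fg: "trisector_pair f g" and C: "C\<^sub>1 = {(x, f x) | x. True}"
    using trisector_curves_are_graphs[OF assms] .
  assume "algebraic_curve C\<^sub>1"
  then obtain P where "P \<noteq> 0" "\<forall>(x, y) \<in> C\<^sub>1. poly_xy P x y = 0"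
    unfolding algebraic_curve_def by blast
  moreover obtain x where "poly_xy P x (f x) \<noteq> 0"
    using trisector_pair.graph_not_algebraic[OF fg \<open>P \<noteq> 0\<close>] by blast
  ultimately show False unfolding C by blast
qed

end
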